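(* Fix a finite alphabet $\Sigma$ and a DTD $D$ over $\Sigma$. There is a deterministic bidirectional two-pass streaming algorithm (with no auxiliary streams) which, given as input stream $\mathrm{XML}(\mathrm{FCNS}^{\bot}(t))$ for a tree $t$ with $N$ nodes, decides whether $t$ is valid against $D$, using $\mathrm{O}(\log^2 N)$ space and $\mathrm{O}(\log N)$ processing time per letter.
   Context: Trees: finite rooted ordered (unranked) trees whose nodes are labeled by letters of $\Sigma$. For each label $a$ there is an opening tag $a$ and a closing tag $\bar a$; $\mathrm{XML}(s)$ of a tree $s$ is the sequence of tags of a depth-first left-to-right traversal (opening tag on entering a node, closing tag on leaving it). A DTD is a map $D$ from $\Sigma$ to regular expressions over $\Sigma$; a node labeled $a$ whose children (in order) are labeled $a_1,\dots,a_k$ is valid if $a_1\cdots a_k$ matches $D(a)$ (a leaf is valid iff the empty word matches $D(a)$); $t$ is valid against $D$ if all its nodes are valid. The DTD is fixed and not counted in the space. The First-Child-Next-Sibling tree $\mathrm{FCNS}(t)$ has the same nodes and root as $t$; the left child of $v$ is its first child in $t$ (if any) and the right child of $v$ is its next sibling in $t$ (if any). $\mathrm{FCNS}^{\bot}(t)$ is the (unannotated) tree obtained from $\mathrm{FCNS}(t)$ by adding, for every node having exactly one of the two children, a new leaf labeled by a fresh symbol $\bot\notin\Sigma$ in the place of the missing child; nodes with no children stay leaves. Streaming model: a pass is a sequential scan of the input; a bidirectional algorithm performs passes in both directions (at least one in each); space is the size of internal memory (in letters and bits); processing time per letter is the maximal running time between two consecutive read operations; arithmetic on integers of size $\mathrm{O}(N)$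 takes constant time. *)

theory Defs
  imports Complex_Main "HOL-Library.Tree" "HOL-Library.Log_Nat" "HOL-Library.Landau_Symbols"
begin

section \<open>Unranked trees, XML streams and DTDs\<close>

datatype 'a utree = UNode (label: 'a) (children: "'a utree list")

primrec num_nodes :: "'a utree \<Rightarrow> nat" where
  "num_nodes (UNode a ts) = Suc (sum_list (map num_nodes ts))"

datatype 'a tag = Open 'a | Close 'a

primrec xml :: "'a utree \<Rightarrow> 'a tag list" where
  "xml (UNode a ts) = Open a # concat (map xml ts) @ [Close a]"

datatype 'a rexp =
    Empty
  | Epsilon
  | Atom 'a
  | Alt "'a rexp" "'a rexp"
  | Times "'a rexp" "'a rexp"
  | Star "'a rexp"

primrec lang :: "'a rexp \<Rightarrow> 'a list set" where
  "lang Empty = {}"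
| "lang Epsilon = {[]}"
| "lang (Atom a) = {[a]}"
| "lang (Alt r s) = lang r \<union> lang s"
| "lang (Times r s) = {u @ v | u v. u \<in> lang r \<and> v \<in> lang s}"
| "lang (Star r) = {concat ws | ws. set ws \<subseteq> lang r}"

type_synonym 'a dtd = "'a \<Rightarrow> 'a rexp"

primrec valid :: "'a dtd \<Rightarrow> 'a utree \<Rightarrow> bool" where
  "valid D (UNode a ts) \<longleftrightarrow> map label ts \<in> lang (D a) \<and> list_all (valid D) ts"


section \<open>First-child-next-sibling encoding\<close>

text \<open>
  Binary trees are those of the library, where \<^const>\<open>Leaf\<close> stands for a missing
  child and is not a node.  The encoding is defined on the list consisting of a node and its
  following siblings.
\<close>

fun fcns_forest :: "'a utree list \<Rightarrow> 'a tree" where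
  "fcns_forest [] = Leaf"
| "fcns_forest (UNode a ts # us) = Node (fcns_forest ts) a (fcns_forest us)"

definition fcns :: "'a utree \<Rightarrow> 'a tree" where
  "fcns t = fcns_forest [t]"

text \<open>
  The extended alphabet is \<^typ>\<open>'a option\<close>: \<^const>\<open>None\<close> is the fresh symbol
  \<open>\<bottom>\<close>.  Only a missing child whose sibling is present is replaced by a \<open>\<bottom>\<close>-leaf.
  The case of \<^const>\<open>Leaf\<close> at the root is irrelevant, as \<^term>\<open>fcns t\<close> has a root.
\<close>

fun add_bot :: "'a tree \<Rightarrow> 'a option utree" where
  "add_bot Leaf = UNode None []"
| "add_bot (Node l a r) =
     UNode (Some a) (if l = Leaf \<and> r = Leaf then [] else [add_bot l, add_bot r])"

definition fcns_bot :: "'a utree \<Rightarrow> 'a option utree" where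
  "fcns_bot t = add_bot (fcns t)"


section \<open>Streaming algorithms on a word RAM\<close>

text \<open>
  The internal memory consists of \<open>m\<close> words, each holding an integer in \<open>{0..V}\<close>; the program
  is a deterministic while-program over it, whose only access to the input is to test the symbol
  last read.  There is no further storage and no output stream.

  Every elementary operation costs one time unit.  In return, no address may reach \<open>m\<close>, and no
  value may exceed \<open>V\<close>, intermediate results included: an execution that violates this has
  no result.  Thus \<open>m\<close> and \<open>V\<close> do not influence the outcome other than by excluding executions,
  and programs cannot access them.
\<close>

type_synonym mem = "nat \<Rightarrow> nat"

datatype aop = Add | Sub | Mul | Div | Mod

primrec aop_fun :: "aop \<Rightarrow> nat \<Rightarrow> nat \<Rightarrow> nat" where
  "aop_fun Add = (+)"
| "aop_fun Sub = (-)"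
| "aop_fun Mul = (*)"
| "aop_fun Div = (div)"
| "aop_fun Mod = (mod)"

datatype aexp = Const nat | Load aexp | Arith aop aexp aexp

primrec aval :: "mem \<Rightarrow> aexp \<Rightarrow> nat" where
  "aval \<sigma> (Const n) = n"
| "aval \<sigma> (Load e) = \<sigma> (aval \<sigma> e)"
| "aval \<sigma> (Arith f e1 e2) = aop_fun f (aval \<sigma> e1) (aval \<sigma> e2)"

primrec asafe :: "nat \<Rightarrow> nat \<Rightarrow> mem \<Rightarrow> aexp \<Rightarrow> bool" where
  "asafe m V \<sigma> (Const n) \<longleftrightarrow> n \<le> V"
| "asafe m V \<sigma> (Load e) \<longleftrightarrow> asafe m V \<sigma> e \<and> aval \<sigma> e < m"
| "asafe m V \<sigma> (Arith f e1 e2) \<longleftrightarrow>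
     asafe m V \<sigma> e1 \<and> asafe m V \<sigma> e2 \<and> aop_fun f (aval \<sigma> e1) (aval \<sigma> e2) \<le> V"

primrec acost :: "aexp \<Rightarrow> nat" where
  "acost (Const n) = 1"
| "acost (Load e) = Suc (acost e)"
| "acost (Arith f e1 e2) = Suc (acost e1 + acost e2)"

text \<open>
  The symbol last read is \<^term>\<open>Some x\<close> for a letter \<open>x\<close> of the stream and
  \<^const>\<open>None\<close> for the end of the stream.
\<close>

datatype 'i bexp =
    Letter 'i
  | EndOfStream
  | Less aexp aexp
  | Equal aexp aexp
  | Neg "'i bexp"
  | Conj "'i bexp" "'i bexp"

primrec bval :: "'i option \<Rightarrow> mem \<Rightarrow> 'i bexp \<Rightarrow> bool" where
  "bval x \<sigma> (Letter y) \<longleftrightarrow> x = Some y"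
| "bval x \<sigma> EndOfStream \<longleftrightarrow> x = None"
| "bval x \<sigma> (Less e1 e2) \<longleftrightarrow> aval \<sigma> e1 < aval \<sigma> e2"
| "bval x \<sigma> (Equal e1 e2) \<longleftrightarrow> aval \<sigma> e1 = aval \<sigma> e2"
| "bval x \<sigma> (Neg b) \<longleftrightarrow> \<not> bval x \<sigma> b"
| "bval x \<sigma> (Conj b1 b2) \<longleftrightarrow> bval x \<sigma> b1 \<and> bval x \<sigma> b2"

primrec bsafe :: "nat \<Rightarrow> nat \<Rightarrow> mem \<Rightarrow> 'i bexp \<Rightarrow> bool" where
  "bsafe m V \<sigma> (Letter y) \<longleftrightarrow> True"
| "bsafe m V \<sigma> EndOfStream \<longleftrightarrow> True"
| "bsafe m V \<sigma> (Less e1 e2) \<longleftrightarrow> asafe m V \<sigma> e1 \<and> asafe m V \<sigma> e2"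
| "bsafe m V \<sigma> (Equal e1 e2) \<longleftrightarrow> asafe m V \<sigma> e1 \<and> asafe m V \<sigma> e2"
| "bsafe m V \<sigma> (Neg b) \<longleftrightarrow> bsafe m V \<sigma> b"
| "bsafe m V \<sigma> (Conj b1 b2) \<longleftrightarrow> bsafe m V \<sigma> b1 \<and> bsafe m V \<sigma> b2"

primrec bcost :: "'i bexp \<Rightarrow> nat" where
  "bcost (Letter y) = 1"
| "bcost EndOfStream = 1"
| "bcost (Less e1 e2) = Suc (acost e1 + acost e2)"
| "bcost (Equal e1 e2) = Suc (acost e1 + acost e2)"
| "bcost (Neg b) = Suc (bcost b)"
| "bcost (Conj b1 b2) = Suc (bcost b1 + bcost b2)"

datatype 'i com =
    Skip
  | Store aexp aexp
  | Seq "'i com" "'i com"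
  | Cond "'i bexp" "'i com" "'i com"
  | Loop "'i bexp" "'i com"

text \<open>
  \<open>exec m V x c \<sigma> k \<sigma>'\<close>: with \<open>x\<close> the symbol last read, \<open>c\<close> started in memory \<open>\<sigma>\<close>
  terminates after \<open>k\<close> time units in memory \<open>\<sigma>'\<close>.
\<close>

inductive exec :: "nat \<Rightarrow> nat \<Rightarrow> 'i option \<Rightarrow> 'i com \<Rightarrow> mem \<Rightarrow> nat \<Rightarrow> mem \<Rightarrow> bool"
  for m V :: nat and x :: "'i option" where
  Skip: "exec m V x Skip \<sigma> 1 \<sigma>"
| Store: "asafe m V \<sigma> e1 \<Longrightarrow> asafe m V \<sigma> e2 \<Longrightarrow> aval \<sigma> e1 < m \<Longrightarrow>
    exec m V x (Store e1 e2) \<sigma> (Suc (acost e1 + acost e2)) (\<sigma>(aval \<sigma> e1 := aval \<sigma> e2))"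
| Seq: "exec m V x c1 \<sigma> k1 \<sigma>1 \<Longrightarrow> exec m V x c2 \<sigma>1 k2 \<sigma>2 \<Longrightarrow>
    exec m V x (Seq c1 c2) \<sigma> (k1 + k2) \<sigma>2"
| CondTrue: "bsafe m V \<sigma> b \<Longrightarrow> bval x \<sigma> b \<Longrightarrow> exec m V x c1 \<sigma> k \<sigma>' \<Longrightarrow>
    exec m V x (Cond b c1 c2) \<sigma> (Suc (bcost b + k)) \<sigma>'"
| CondFalse: "bsafe m V \<sigma> b \<Longrightarrow> \<not> bval x \<sigma> b \<Longrightarrow> exec m V x c2 \<sigma> k \<sigma>' \<Longrightarrow>
    exec m V x (Cond b c1 c2) \<sigma> (Suc (bcost b + k)) \<sigma>'"
| LoopFalse: "bsafe m V \<sigma> b \<Longrightarrow> \<not> bval x \<sigma> b \<Longrightarrow>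
    exec m V x (Loop b c) \<sigma> (Suc (bcost b)) \<sigma>"
| LoopTrue: "bsafe m V \<sigma> b \<Longrightarrow> bval x \<sigma> b \<Longrightarrow> exec m V x c \<sigma> k1 \<sigma>1 \<Longrightarrow>
    exec m V x (Loop b c) \<sigma>1 k2 \<sigma>2 \<Longrightarrow>
    exec m V x (Loop b c) \<sigma> (Suc (bcost b + k1 + k2)) \<sigma>2"

text \<open>
  A pass is given by its direction and the command that is executed after each read operation,
  including the one that returns the end-of-stream symbol; \<open>T\<close> bounds the time of each of these
  executions, that is, between two consecutive read operations.
\<close>

datatype direction = Forward | Backward

type_synonym 'i streaming_alg = "(direction \<times> 'i com) list"

primrec scan :: "nat \<Rightarrow> nat \<Rightarrow> nat \<Rightarrow> 'i com \<Rightarrow> 'i option list \<Rightarrow> mem \<Rightarrow> mem \<Rightarrow> bool" where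
  "scan m V T c [] \<sigma> \<sigma>' \<longleftrightarrow> \<sigma>' = \<sigma>"
| "scan m V T c (x # xs) \<sigma> \<sigma>' \<longleftrightarrow>
     (\<exists>k \<sigma>1. exec m V x c \<sigma> k \<sigma>1 \<and> k \<le> T \<and> scan m V T c xs \<sigma>1 \<sigma>')"

primrec read_sequence :: "direction \<Rightarrow> 'i list \<Rightarrow> 'i option list" where
  "read_sequence Forward w = map Some w @ [None]"
| "read_sequence Backward w = map Some (rev w) @ [None]"

fun run :: "nat \<Rightarrow> nat \<Rightarrow> nat \<Rightarrow> 'i list \<Rightarrow> 'i streaming_alg \<Rightarrow> mem \<Rightarrow> mem \<Rightarrow> bool" where
  "run m V T w [] \<sigma> \<sigma>' \<longleftrightarrow> \<sigma>' = \<sigma>"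
| "run m V T w ((d, c) # ps) \<sigma> \<sigma>' \<longleftrightarrow>
     (\<exists>\<sigma>1. scan m V T c (read_sequence d w) \<sigma> \<sigma>1 \<and> run m V T w ps \<sigma>1 \<sigma>')"

definition bidirectional :: "'i streaming_alg \<Rightarrow> bool" where
  "bidirectional A \<longleftrightarrow> {Forward, Backward} \<subseteq> fst ` set A"

text \<open>
  The memory is initially zero, and the input is accepted iff word \<open>0\<close> finally contains \<open>1\<close>.
  In particular \<open>outputs\<close> requires that the computation terminates within the given resources.
\<close>

definition outputs :: "nat \<Rightarrow> nat \<Rightarrow> nat \<Rightarrow> 'i streaming_alg \<Rightarrow> 'i list \<Rightarrow> bool \<Rightarrow> bool" where
  "outputs m V T A w b \<longleftrightarrow> (\<exists>\<sigma>. run m V T w A (\<lambda>_. 0) \<sigma> \<and> (\<sigma> 0 = 1 \<longleftrightarrow> b))"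

text \<open>
  Memory size in letters and bits: the symbol last read, and \<open>m\<close> words of the number of bits
  needed to represent \<open>V\<close>.
\<close>

definition space :: "nat \<Rightarrow> nat \<Rightarrow> nat" where
  "space m V = 1 + m * floorlog 2 V"

end

(*
  In FCNS(t) the children of a node v are spelled by the right spine of its left subtree, so the
  check at v compares a summary of the left subtree L(v) with the label of v.  Read forwards, the
  summary is available after L(v) and has to be kept during the right subtree R(v); read backwards,
  it is available at the beginning of L(v) and has to be kept until L(v) ends.  In both cases one
  keeps something from the point between the two subtrees of v until the second one has been read.
  A pass keeps these values on a stack but discards an entry once the second subtree turns out to
  be longer than the stretch of the stream between the entry below and this one, a stretch which
  contains the first subtree.  The check is then lost in this pass, but the pass in the other
  direction carries it out.  The distances from the reading head to the remaining entries double
  from one to the next, so there are only O(log N) of them.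
*)
theory Submission
  imports Defs "HOL-Library.FuncSet"
begin

section \<open>Automata for regular expressions\<close>

text \<open>Both passes are instances of one stack machine, \<open>tree_machine\<close>: the
  backward pass sees the mirrored tree, so only the updates of the register and of the stack differ.
  A summary is checked at the last move of a node, where the label is read again; nothing is
  remembered about that label while the summary is computed. Hence one automaton has to serve all
  labels, and only its accepting sets depend on the label. Which checks a pass really makes depends
  on what the stack held when it was last compacted. The verdict of a pass is therefore enclosed
  rather than computed: it is positive if all checks hold (\<open>all_ok\<close>), and if positive
  it guarantees those at nodes whose second subtree is not longer than the first
  (\<open>heavy_ok\<close>). These two bounds suffice to combine the passes. The stack is compacted
  only at a push. One sweep over a stack of logarithmic height already meets the bound for a single
  letter, without amortization.\<close>

definition left_quotient :: "'a \<Rightarrow> 'a list set \<Rightarrow> 'a list set" where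
  "left_quotient c L = {w. c # w \<in> L}"

definition quotient_closed :: "'a list set set \<Rightarrow> bool" where
  "quotient_closed Q \<longleftrightarrow> (\<forall>X\<in>Q. \<forall>c. left_quotient c X \<in> Q)"

definition conc :: "'a list set \<Rightarrow> 'a list set \<Rightarrow> 'a list set" where
  "conc A B = {u @ v | u v. u \<in> A \<and> v \<in> B}"

definition star :: "'a list set \<Rightarrow> 'a list set" where
  "star A = {concat ws | ws. set ws \<subseteq> A}"

lemma left_quotient_Un: "left_quotient c (A \<union> B) = left_quotient c A \<union> left_quotient c B"
  by (auto simp: left_quotient_def)

lemma left_quotient_Union: "left_quotient c (\<Union>Y) = \<Union>(left_quotient c ` Y)"
  by (auto simp: left_quotient_def)

lemma left_quotient_conc:
  "left_quotient c (conc A B) =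
     conc (left_quotient c A) B \<union> (if [] \<in> A then left_quotient c B else {})"
  (is "?l = ?r")
proof
  show "?l \<subseteq> ?r"
  proof
    fix w assume "w \<in> ?l"
    then obtain u v where uv: "c # w = u @ v" "u \<in> A" "v \<in> B"
      by (auto simp: left_quotient_def conc_def)
    show "w \<in> ?r"
    proof (cases u)
      case Nil
      with uv show ?thesis by (auto simp: left_quotient_def)
    next
      case (Cons b u')
      with uv show ?thesis by (auto simp: left_quotient_def conc_def)
    qed
  qed
  show "?r \<subseteq> ?l"
  proof
    fix w assume "w \<in> ?r"
    then consider u v where "w = u @ v" "c # u \<in> A" "v \<in> B" | "[] \<in> A" "c # w \<in> B"
      by (auto simp: left_quotient_def conc_def split: if_splits)
    then show "w \<in> ?l"
    proof cases
      case 1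
      then have "c # w = (c # u) @ v" by simp
      with 1 show ?thesis unfolding left_quotient_def conc_def by blast
    next
      case 2
      then have "c # w = [] @ (c # w)" by simp
      with 2 show ?thesis unfolding left_quotient_def conc_def by blast
    qed
  qed
qed

lemma left_quotient_star: "left_quotient c (star A) = conc (left_quotient c A) (star A)"
  (is "?l = ?r")
proof
  show "?l \<subseteq> ?r"
  proof
    fix w assume "w \<in> ?l"
    then obtain ws where "c # w = concat ws" "set ws \<subseteq> A"
      by (auto simp: left_quotient_def star_def)
    then show "w \<in> ?r"
    proof (induction ws)
      case Nil
      then show ?case by simp
    next
      case (Cons u ws)
      show ?case
      proof (cases u)
        case Nil
        with Cons show ?thesis by simp
      next
        case (Cons b u')
        with Cons.prems have "w = u' @ concat ws" "u' \<in> left_quotient c A" "concat ws \<in> star A"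
          by (auto simp: left_quotient_def star_def)
        then show ?thesis by (auto simp: conc_def)
      qed
    qed
  qed
  show "?r \<subseteq> ?l"
  proof
    fix w assume "w \<in> ?r"
    then obtain u ws where "w = u @ concat ws" "c # u \<in> A" "set ws \<subseteq> A"
      by (auto simp: left_quotient_def star_def conc_def)
    then have "c # w = concat ((c # u) # ws)" "set ((c # u) # ws) \<subseteq> A"
      by auto
    then show "w \<in> ?l"
      unfolding left_quotient_def star_def by blast
  qed
qed

text \<open>A letter either continues the word from \<open>X\<close> or, once \<open>X\<close>
  accepts the empty word, begins the word from \<open>B\<close>; \<open>Y\<close> collects the
  quotients of \<open>B\<close> reached after such beginnings.\<close>

lemma quotient_closed_conc:
  assumes "quotient_closed P" "quotient_closed Q" "B \<in> Q"
  shows "quotient_closed {conc X B \<union> \<Union>Y | X Y. X \<in> P \<and> Y \<subseteq> Q}"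
  unfolding quotient_closed_def
proof (intro ballI allI)
  fix Z c assume "Z \<in> {conc X B \<union> \<Union>Y | X Y. X \<in> P \<and> Y \<subseteq> Q}"
  then obtain X Y where Z: "Z = conc X B \<union> \<Union>Y" "X \<in> P" "Y \<subseteq> Q" by auto
  define Y' where "Y' = left_quotient c ` Y \<union> (if [] \<in> X then {left_quotient c B} else {})"
  have "left_quotient c Z = conc (left_quotient c X) B \<union> \<Union>Y'"
    by (auto simp: Z Y'_def left_quotient_Un left_quotient_Union left_quotient_conc)
  moreover have "left_quotient c X \<in> P" "Y' \<subseteq> Q"
    using assms Z by (auto simp: Y'_def quotient_closed_def)
  ultimately show "left_quotient c Z \<in> {conc X B \<union> \<Union>Y | X Y. X \<in> P \<and> Y \<subseteq> Q}"
    by blast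
qed

text \<open>After the first letter a word from \<open>A\<close> is always in progress, followed by
  arbitrarily many others; only the initial \<open>star A\<close> is not of this form.\<close>

lemma quotient_closed_star:
  assumes "quotient_closed Q" "A \<in> Q"
  shows "quotient_closed (insert (star A) {\<Union>X\<in>Y. conc X (star A) | Y. Y \<subseteq> Q})"
  unfolding quotient_closed_def
proof (intro ballI allI)
  let ?S = "{\<Union>X\<in>Y. conc X (star A) | Y. Y \<subseteq> Q}"
  fix Z c assume "Z \<in> insert (star A) ?S"
  then consider "Z = star A" | Y where "Z = (\<Union>X\<in>Y. conc X (star A))" "Y \<subseteq> Q" by auto
  then have "left_quotient c Z \<in> ?S"
  proof cases
    case 1
    then have "left_quotient c Z = (\<Union>X\<in>{left_quotient c A}. conc X (star A))"
      by (simp add: left_quotient_star)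
    moreover have "{left_quotient c A} \<subseteq> Q" using assms by (auto simp: quotient_closed_def)
    ultimately show ?thesis by blast
  next
    case 2
    \<comment> \<open>If the word in progress may end here, the letter may also begin the next word
      of the star.\<close>
    define Y' where
      "Y' = left_quotient c ` Y \<union> (if \<exists>X\<in>Y. [] \<in> X then {left_quotient c A} else {})"
    have "left_quotient c Z = (\<Union>X\<in>Y'. conc X (star A))"
      by (auto simp: 2 Y'_def left_quotient_Union left_quotient_conc left_quotient_star
          split: if_splits)
    moreover have "Y' \<subseteq> Q"
      using assms 2 by (auto simp: Y'_def quotient_closed_def)
    ultimately show ?thesis by blast
  qed
  then show "left_quotient c Z \<in> insert (star A) ?S" by simp
qed

text \<open>Asking for a finite closed family around \<open>lang r\<close>, instead of the exact set
  of its quotients, makes the induction go through: the families for \<open>Times\<close> and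
  \<open>Star\<close> are indexed by subsets of the given ones.\<close>

lemma finitely_many_quotients: "\<exists>Q. finite Q \<and> lang r \<in> Q \<and> quotient_closed Q"
proof (induction r)
  case Empty
  show ?case by (rule exI[of _ "{{}}"]) (simp add: quotient_closed_def left_quotient_def)
next
  case Epsilon
  show ?case by (rule exI[of _ "{{}, {[]}}"]) (simp add: quotient_closed_def left_quotient_def)
next
  case (Atom a)
  have "{w. (c::'a) = a \<and> w = []} = (if c = a then {[]} else {})" for c by auto
  then show ?case
    by (intro exI[of _ "{{}, {[]}, {[a]}}"]) (simp add: quotient_closed_def left_quotient_def)
next
  case (Alt r s)
  then obtain P Q where PQ: "finite P" "lang r \<in> P" "quotient_closed P"
    "finite Q" "lang s \<in> Q" "quotient_closed Q" by blast
  have "quotient_closed ((\<lambda>(X, Y). X \<union> Y) ` (P \<times> Q))"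
    unfolding quotient_closed_def
  proof (intro ballI allI)
    fix Z c assume "Z \<in> (\<lambda>(X, Y). X \<union> Y) ` (P \<times> Q)"
    then obtain X Y where "Z = X \<union> Y" "X \<in> P" "Y \<in> Q" by auto
    with PQ show "left_quotient c Z \<in> (\<lambda>(X, Y). X \<union> Y) ` (P \<times> Q)"
      by (intro image_eqI[of _ _ "(left_quotient c X, left_quotient c Y)"])
        (auto simp: quotient_closed_def left_quotient_Un)
  qed
  with PQ show ?case
    by (intro exI[of _ "(\<lambda>(X, Y). X \<union> Y) ` (P \<times> Q)"]) auto
next
  case (Times r s)
  then obtain P Q where PQ: "finite P" "lang r \<in> P" "quotient_closed P"
    "finite Q" "lang s \<in> Q" "quotient_closed Q" by blast
  let ?S = "{conc X (lang s) \<union> \<Union>Y | X Y. X \<in> P \<and> Y \<subseteq> Q}"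
  have "?S = (\<lambda>(X, Y). conc X (lang s) \<union> \<Union>Y) ` (P \<times> Pow Q)" by auto
  then have "finite ?S" using PQ by simp
  moreover have "lang (Times r s) = conc (lang r) (lang s) \<union> \<Union>{}" by (simp add: conc_def)
  then have "lang (Times r s) \<in> ?S" using PQ by blast
  ultimately show ?case using quotient_closed_conc[OF PQ(3,6,5)] by blast
next
  case (Star r)
  then obtain Q where Q: "finite Q" "lang r \<in> Q" "quotient_closed Q" by blast
  let ?S = "insert (star (lang r)) {\<Union>X\<in>Y. conc X (star (lang r)) | Y. Y \<subseteq> Q}"
  have "?S = insert (star (lang r)) ((\<lambda>Y. \<Union>X\<in>Y. conc X (star (lang r))) ` Pow Q)" by auto
  then have "finite ?S" using Q by simp
  moreover have "lang (Star r) = star (lang r)" by (simp add: star_def)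
  ultimately show ?case using quotient_closed_star[OF Q(3,2)] by auto
qed

lemma fold_left_quotient: "fold left_quotient w L = {u. w @ u \<in> L}"
  by (induction w arbitrary: L) (auto simp: left_quotient_def)

text \<open>The product of the quotient automata of all labels: a state assigns to each label the
  remaining language. The initial state has to be 0 because registers and memory start with
  0.\<close>

lemma dtd_automaton:
  fixes D :: "'a::finite dtd"
  obtains K :: nat and \<delta> :: "'a \<Rightarrow> nat \<Rightarrow> nat" and F where
    "0 < K" "\<And>a q. q < K \<Longrightarrow> \<delta> a q < K" "\<And>a w. fold \<delta> w 0 \<in> F a \<longleftrightarrow> w \<in> lang (D a)"
proof -
  have "\<forall>a. \<exists>Q. finite Q \<and> lang (D a) \<in> Q \<and> quotient_closed Q"
    using finitely_many_quotients by blast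
  then obtain Q where Q: "\<And>a. finite (Q a)" "\<And>a. lang (D a) \<in> Q a" "\<And>a. quotient_closed (Q a)"
    by metis
  define S where "S = Pi UNIV Q"
  define T where "T c f = (\<lambda>a. left_quotient c (f a))" for c :: 'a and f :: "'a \<Rightarrow> 'a list set"
  define I where "I = (\<lambda>a. lang (D a))"
  have "finite S"
    unfolding S_def using finite_PiE[of UNIV Q] Q(1) by (simp add: PiE_UNIV_domain)
  have I: "I \<in> S" using Q(2) by (auto simp: S_def I_def)
  have T: "T c f \<in> S" if "f \<in> S" for c f
    using that Q(3) by (auto simp: S_def T_def quotient_closed_def)
  obtain e :: "('a \<Rightarrow> 'a list set) \<Rightarrow> nat" and n where e: "e ` S = {i. i < n}" "inj_on e S"
    using finite_imp_inj_to_nat_seg[OF \<open>finite S\<close>] by blast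
  \<comment> \<open>Shifting the numbering by one frees the number 0 for the initial state.\<close>
  define e' where "e' f = (if f = I then 0 else Suc (e f))" for f
  have inj: "inj_on e' S" using e(2) by (auto simp: e'_def inj_on_def)
  have e'_less: "e' f < Suc n" if "f \<in> S" for f
    using that e(1) by (auto simp: e'_def)
  \<comment> \<open>Numbers below the bound that name no state are sent to 0, so that the bound is
    respected for every \<open>q\<close>.\<close>
  define \<delta> where "\<delta> c q = (if q \<in> e' ` S then e' (T c (inv_into S e' q)) else 0)" for c q
  have \<delta>: "\<delta> c (e' f) = e' (T c f)" if "f \<in> S" for c f
    using that inj by (simp add: \<delta>_def)
  have fold: "fold \<delta> w (e' f) = e' (fold T w f) \<and> fold T w f \<in> S" if "f \<in> S" for w f
    using that by (induction w arbitrary: f) (simp_all add: \<delta> T)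
  have fold_T: "fold T w f a = fold left_quotient w (f a)" for w f a
    by (induction w arbitrary: f) (simp_all add: T_def)
  show ?thesis
  proof (rule that)
    show "0 < Suc n" by simp
    show "\<delta> a q < Suc n" if "q < Suc n" for a q
    proof (cases "q \<in> e' ` S")
      case True
      then show ?thesis using e'_less T by (auto simp: \<delta> simp del: less_Suc_eq_le)
    next
      case False
      then show ?thesis by (simp add: \<delta>_def)
    qed
    show "fold \<delta> w 0 \<in> e' ` {f \<in> S. [] \<in> f a} \<longleftrightarrow> w \<in> lang (D a)" for a w
    proof -
      have "e' I = 0" by (simp add: e'_def)
      then have "fold \<delta> w 0 = e' (fold T w I)" "fold T w I \<in> S" using fold[OF I, of w] by simp_all
      then have "fold \<delta> w 0 \<in> e' ` {f \<in> S. [] \<in> f a} \<longleftrightarrow> [] \<in> fold T w I a"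
        using inj by (auto simp: inj_on_def)
      then show ?thesis by (simp add: fold_T fold_left_quotient I_def)
    qed
  qed
qed

section \<open>Reversal of regular expressions\<close>

primrec rexp_rev :: "'a rexp \<Rightarrow> 'a rexp" where
  "rexp_rev Empty = Empty"
| "rexp_rev Epsilon = Epsilon"
| "rexp_rev (Atom a) = Atom a"
| "rexp_rev (Alt r s) = Alt (rexp_rev r) (rexp_rev s)"
| "rexp_rev (Times r s) = Times (rexp_rev s) (rexp_rev r)"
| "rexp_rev (Star r) = Star (rexp_rev r)"

lemma rev_image_star: "rev ` star A = star (rev ` A)"
proof
  show "rev ` star A \<subseteq> star (rev ` A)"
  proof
    fix w assume "w \<in> rev ` star A"
    then obtain ws where "w = rev (concat ws)" "set ws \<subseteq> A" by (auto simp: star_def)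
    then have "w = concat (map rev (rev ws))" "set (map rev (rev ws)) \<subseteq> rev ` A"
      by (auto simp: rev_concat rev_map)
    then show "w \<in> star (rev ` A)" unfolding star_def by blast
  qed
  show "star (rev ` A) \<subseteq> rev ` star A"
  proof
    fix w assume "w \<in> star (rev ` A)"
    then obtain ws where ws: "w = concat ws" "set ws \<subseteq> rev ` A" by (auto simp: star_def)
    then have "rev w = concat (map rev (rev ws))" "set (map rev (rev ws)) \<subseteq> A"
      by (auto simp: rev_concat rev_map)
    then have "rev w \<in> star A" unfolding star_def by blast
    then show "w \<in> rev ` star A" by (metis image_eqI rev_rev_ident)
  qed
qed

lemma lang_rexp_rev: "lang (rexp_rev r) = rev ` lang r"
proof (induction r)
  case (Times r s)
  show ?case
    unfolding rexp_rev.simps lang.simps Times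
    by (auto simp: image_iff) (metis rev_append)+
next
  case (Star r)
  have "lang (Star s) = star (lang s)" for s :: "'a rexp" by (simp add: star_def)
  with Star show ?case by (simp only: rexp_rev.simps rev_image_star)
qed (simp_all add: image_Un)

text \<open>This serves the forward pass, which leaves siblings from right to left: an automaton for
  the reversed languages consumes their labels in this order.\<close>

lemma dtd_automaton_rev:
  fixes D :: "'a::finite dtd"
  obtains K :: nat and \<delta> :: "'a \<Rightarrow> nat \<Rightarrow> nat" and F where
    "0 < K" "\<And>a q. q < K \<Longrightarrow> \<delta> a q < K" "\<And>a w. foldr \<delta> w 0 \<in> F a \<longleftrightarrow> w \<in> lang (D a)"
proof (rule dtd_automaton[of "rexp_rev \<circ> D"])
  fix K :: nat and \<delta> :: "'a \<Rightarrow> nat \<Rightarrow> nat" and F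
  assume *: "0 < K" "\<And>a q. q < K \<Longrightarrow> \<delta> a q < K"
    "\<And>a w. fold \<delta> w 0 \<in> F a \<longleftrightarrow> w \<in> lang ((rexp_rev \<circ> D) a)"
  have "foldr \<delta> w 0 \<in> F a \<longleftrightarrow> w \<in> lang (D a)" for a w
    using *(3)[of "rev w" a] by (auto simp: lang_rexp_rev foldr_conv_fold inj_image_mem_iff)
  with * that show ?thesis by blast
qed

section \<open>The stack machine\<close>

datatype 'b ftree = FLeaf 'b | FNode 'b "'b ftree" "'b ftree"

datatype 'b move = Down 'b | Up 'b

fun moves :: "'b ftree \<Rightarrow> 'b move list" where
  "moves (FLeaf a) = [Down a, Up a]"
| "moves (FNode a l r) = Down a # moves l @ moves r @ [Up a]"

datatype entry = Entry (depth: nat) (pos: nat) (state: nat)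

definition thin :: "nat \<Rightarrow> entry \<Rightarrow> entry \<Rightarrow> bool" where
  "thin n x y \<longleftrightarrow> pos x - pos y < n - pos x"

text \<open>The decision is made from the bottom upwards and against the nearest survivor, since
  each removal widens the gap below the next entry and may thereby save it.\<close>

fun compact_stack :: "nat \<Rightarrow> entry list \<Rightarrow> entry list" where
  "compact_stack n (x # y # st) =
     (let st' = compact_stack n (y # st) in if thin n x (hd st') then st' else x # st')"
| "compact_stack n st = st"

text \<open>
  A configuration consists of the position in the stream, the depth, whether the last move was
  upwards, a register and a stack, and whether all checks so far have succeeded.  The bottom entry
  of the stack is a sentinel and is never popped.
\<close>

datatype conf = Conf nat nat bool nat "entry list" bool

locale tree_machine =
  fixes g h :: "'b \<Rightarrow> nat \<Rightarrow> nat" and chk :: "'b \<Rightarrow> nat \<Rightarrow> bool"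
begin

fun upd_top :: "'b \<Rightarrow> entry list \<Rightarrow> entry list" where
  "upd_top a (Entry e p s # st) = Entry e p (g a s) # st"
| "upd_top a [] = []"

text \<open>Nodes have no or two subtrees. So a downward move after an upward one begins a second
  subtree, and the register then holds the value of the first. An upward move after a downward one
  leaves a leaf, where the word of children is empty. Otherwise the depth of the top entry tells
  whether the entry of the node has survived.\<close>

fun step :: "'b move \<Rightarrow> conf \<Rightarrow> conf" where
  "step (Down a) (Conf n d up r st ok) =
     (if up then Conf (Suc n) (Suc d) False 0 (upd_top a (Entry d n r # compact_stack n st)) ok
      else Conf (Suc n) (Suc d) False r (upd_top a st) ok)"
| "step (Up a) (Conf n d up r st ok) =
     (if up then
        if depth (hd st) = d \<and> tl st \<noteq> [] then Conf (Suc n) (d - 1) True (h a r) (tl st)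
          (ok \<and> chk a (state (hd st)))
        else Conf (Suc n) (d - 1) True (h a r) st ok
      else Conf (Suc n) (d - 1) True (h a r) st (ok \<and> chk a 0))"

fun up_val :: "'b ftree \<Rightarrow> nat" where
  "up_val (FLeaf a) = h a 0"
| "up_val (FNode a l r) = h a (up_val r)"

text \<open>The nodes on the path of first children are entered in a row right after the push. The
  state of the entry is thus final before the next compaction can remove it.\<close>

fun down_val :: "'b ftree \<Rightarrow> nat \<Rightarrow> nat" where
  "down_val (FLeaf a) s = g a s"
| "down_val (FNode a l r) s = down_val l (g a s)"

fun all_ok :: "'b ftree \<Rightarrow> bool" where
  "all_ok (FLeaf a) = chk a 0"
| "all_ok (FNode a l r) \<longleftrightarrow> chk a (down_val r (up_val l)) \<and> all_ok l \<and> all_ok r"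

fun heavy_ok :: "'b ftree \<Rightarrow> bool" where
  "heavy_ok (FLeaf a) = chk a 0"
| "heavy_ok (FNode a l r) \<longleftrightarrow>
     (length (moves r) \<le> length (moves l) \<longrightarrow> chk a (down_val r (up_val l))) \<and>
     heavy_ok l \<and> heavy_ok r"

end

text \<open>The cumulative effect of compactions at positions up to \<open>n\<close>. Entries are
  compared with their neighbour in the original stack, which lies at or above the surviving one.
  This demand is weaker than what \<open>compact_stack\<close> tests, but later removals cannot
  spoil it; hence transitivity.\<close>

inductive thins :: "nat \<Rightarrow> entry list \<Rightarrow> entry list \<Rightarrow> bool" for n where
  base: "thins n [x] [x]"
| keep: "thins n st st' \<Longrightarrow> thins n (x # st) (x # st')"
| drop: "thins n (y # st) st' \<Longrightarrow> thin n x y \<Longrightarrow> thins n (x # y # st) st'"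

abbreviation descending :: "entry list \<Rightarrow> bool" where
  "descending \<equiv> sorted_wrt (\<lambda>x y. pos y \<le> pos x)"

lemma thins_nonempty: "thins n st st' \<Longrightarrow> st \<noteq> [] \<and> st' \<noteq> []"
  by (induction rule: thins.induct) auto

lemma thins_subset: "thins n st st' \<Longrightarrow> set st' \<subseteq> set st"
  by (induction rule: thins.induct) auto

lemma thins_descending: "thins n st st' \<Longrightarrow> descending st \<Longrightarrow> descending st'"
  by (induction rule: thins.induct) (use thins_subset in fastforce)+

lemma pos_hd_thins:
  assumes "thins n st st'" "descending st"
  shows "pos (hd st') \<le> pos (hd st)"
proof -
  have "hd st' \<in> set st"
    using thins_nonempty[OF assms(1)] thins_subset[OF assms(1)] by (metis hd_in_set subsetD)
  then show ?thesis using assms(2) by (cases st) auto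
qed

lemma thins_mono: "thins n st st' \<Longrightarrow> n \<le> n' \<Longrightarrow> thins n' st st'"
  by (induction rule: thins.induct) (auto intro: thins.intros simp: thin_def)

lemma thins_Cons_hd: "thins n st st' \<Longrightarrow> thin n x (hd st) \<Longrightarrow> thins n (x # st) st'"
  using thins_nonempty by (cases st) (auto intro: thins.drop)

lemma thins_trans:
  assumes "thins n st st'" "thins n' st' st''" "n \<le> n'" "descending st"
  shows "thins n' st st''"
  using assms
proof (induction arbitrary: st'' rule: thins.induct)
  case (base x)
  then show ?case by simp
next
  case (keep st st' x)
  from keep.prems(1) show ?case
  proof cases
    case (keep st2)
    then show ?thesis
      using keep.prems keep.IH thins_nonempty[OF keep.hyps] by (auto intro: thins.keep)
  next
    case (drop y st2)
    then have "thin n' x (hd st')" by simp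
    \<comment> \<open>The survivor lies no higher than the original neighbour, so the gap to the
      original neighbour is at most as large.\<close>
    then have "thin n' x (hd st)"
      using pos_hd_thins[OF keep.hyps] keep.prems by (auto simp: thin_def)
    moreover have "thins n' st st''" using drop keep.IH keep.prems by simp
    ultimately show ?thesis by (rule thins_Cons_hd[rotated])
  qed (use thins_nonempty[OF keep.hyps] in auto)
next
  case (drop y st st' x)
  then have "thin n' x y" by (auto simp: thin_def)
  with drop show ?case by (auto intro: thins.drop)
qed

lemma thins_refl: "st \<noteq> [] \<Longrightarrow> thins n st st"
  by (induction st rule: induct_list012) (auto intro: thins.intros)

lemma thins_compact: "st \<noteq> [] \<Longrightarrow> descending st \<Longrightarrow> thins n st (compact_stack n st)"
proof (induction n st rule: compact_stack.induct)
  case (1 n x y st)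
  then have IH: "thins n (y # st) (compact_stack n (y # st))" by simp
  have "pos (hd (compact_stack n (y # st))) \<le> pos y"
    using pos_hd_thins[OF IH] 1 by simp
  with IH show ?case
    by (auto simp: Let_def thin_def intro!: thins.keep thins.drop)
qed (auto intro: thins.base)

section \<open>Correctness of one pass, up to the lost checks\<close>

context tree_machine
begin

definition steps :: "'b move list \<Rightarrow> conf \<Rightarrow> conf" where
  "steps ms c = fold step ms c"

lemma steps_append: "steps (xs @ ys) c = steps ys (steps xs c)"
  by (simp add: steps_def)

lemma steps_Cons: "steps (x # ys) c = steps ys (step x c)"
  by (simp add: steps_def)

lemma steps_Nil: "steps [] c = c"
  by (simp add: steps_def)

text \<open>A second subtree behaves like a first one above a fresh entry, so a single induction
  covers both.\<close>

lemma steps_second: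
  "steps (moves t) (Conf n d True r st ok) =
   steps (moves t) (Conf n d False 0 (Entry d n r # compact_stack n st) ok)"
  by (cases t) (simp_all add: steps_Cons)

text \<open>\<open>b\<close> collects the checks made inside \<open>t\<close>. Its value depends on
  the surrounding stack, which decides what is discarded, so it is only bounded from both sides. The
  stack below may lose entries during \<open>t\<close>, and these losses are passed on through
  \<open>thins\<close> until the node owning the entry ends.\<close>

lemma steps_moves:
  assumes "descending (Entry e p s # st)" "p \<le> n" "\<forall>x\<in>set (Entry e p s # st). depth x \<le> d"
  shows "\<exists>st' b. steps (moves t) (Conf n d False 0 (Entry e p s # st) ok) =
      Conf (n + length (moves t)) d True (up_val t) st' (ok \<and> b) \<and>
      thins (n + length (moves t)) (Entry e p (down_val t s) # st) st' \<and>
      (all_ok t \<longrightarrow> b) \<and> (b \<longrightarrow> heavy_ok t)"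
  using assms
proof (induction t arbitrary: n d e p s st ok)
  case (FLeaf a)
  show ?case
    by (simp add: steps_Cons steps_Nil) (use thins_refl in blast)
next
  case (FNode a l r)
  define n1 where "n1 = Suc n + length (moves l)"
  define n2 where "n2 = n1 + length (moves r)"
  let ?x = "Entry e p (down_val l (g a s))"
  obtain st1 b1 where 1:
    "steps (moves l) (Conf (Suc n) (Suc d) False 0 (Entry e p (g a s) # st) ok) =
       Conf n1 (Suc d) True (up_val l) st1 (ok \<and> b1)"
    "thins n1 (?x # st) st1" "all_ok l \<longrightarrow> b1" "b1 \<longrightarrow> heavy_ok l"
    using FNode.IH(1)[of e p "g a s" st "Suc n" "Suc d" ok] FNode.prems unfolding n1_def
    by (auto simp: le_SucI)
  have desc: "descending (?x # st)" using FNode.prems(1) by simp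
  have st1: "descending st1" "st1 \<noteq> []"
    using thins_descending[OF 1(2) desc] thins_nonempty[OF 1(2)] by auto
  define st2 where "st2 = compact_stack n1 st1"
  have 2: "thins n1 (?x # st) st2"
    unfolding st2_def using thins_trans[OF 1(2) thins_compact[OF st1(2,1)] _ desc] by simp
  have st2: "descending st2" "st2 \<noteq> []" "set st2 \<subseteq> set (?x # st)"
    using thins_descending[OF 2 desc] thins_nonempty[OF 2] thins_subset[OF 2] by auto
  have pos_st2: "\<forall>x\<in>set st2. pos x \<le> n" "\<forall>x\<in>set st2. depth x \<le> d"
    using st2(3) FNode.prems by fastforce+
  obtain st3 b2 where 3:
    "steps (moves r) (Conf n1 (Suc d) False 0 (Entry (Suc d) n1 (up_val l) # st2) (ok \<and> b1)) =
       Conf n2 (Suc d) True (up_val r) st3 ((ok \<and> b1) \<and> b2)"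
    "thins n2 (Entry (Suc d) n1 (down_val r (up_val l)) # st2) st3"
    "all_ok r \<longrightarrow> b2" "b2 \<longrightarrow> heavy_ok r"
    using FNode.IH(2)[of "Suc d" n1 "up_val l" st2 n1 "Suc d" "ok \<and> b1"] pos_st2 st2(1)
    unfolding n2_def by (fastforce simp: n1_def)
  let ?y = "Entry (Suc d) n1 (down_val r (up_val l))"
  have whole: "steps (moves (FNode a l r)) (Conf n d False 0 (Entry e p s # st) ok) =
      step (Up a) (Conf n2 (Suc d) True (up_val r) st3 ((ok \<and> b1) \<and> b2))"
    by (simp add: steps_Cons steps_append 1(1) steps_second 3(1) steps_Nil flip: st2_def)
  have len: "n + length (moves (FNode a l r)) = Suc n2"
    by (simp add: n1_def n2_def)
  have "n1 \<le> Suc n2" by (simp add: n2_def)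
  have final: "thins (Suc n2) (?x # st) st'" if "thins n2 st2 st'" for st'
    using thins_trans[OF 2 thins_mono[OF that] \<open>n1 \<le> Suc n2\<close> desc] by simp
  \<comment> \<open>Either the entry of this node has survived its second subtree or it has been
    discarded.\<close>
  from 3(2) show ?case
  proof cases
    case (base)
    then show ?thesis using st2(2) by simp
  next
    case (keep st3')
    then have "steps (moves (FNode a l r)) (Conf n d False 0 (Entry e p s # st) ok) =
      Conf (Suc n2) d True (h a (up_val r)) st3'
        (ok \<and> (b1 \<and> b2 \<and> chk a (down_val r (up_val l))))"
      unfolding whole using keep thins_nonempty by auto
    moreover have "thins (Suc n2) (?x # st) st3'" using final keep by simp
    ultimately show ?thesis
      unfolding len using 1(3,4) 3(3,4)
      by (intro exI[of _ st3'] exI[of _ "b1 \<and> b2 \<and> chk a (down_val r (up_val l))"]) auto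
  next
    case (drop y st2')
    have "set st3 \<subseteq> set st2" "st3 \<noteq> []"
      using drop thins_subset thins_nonempty by blast+
    \<comment> \<open>Older entries have depth at most \<open>d\<close>, so the depth test fails and
      no check is made.\<close>
    then have "depth (hd st3) \<noteq> Suc d"
      using pos_st2(2) by (metis hd_in_set not_less_eq_eq order_refl subsetD)
    then have "steps (moves (FNode a l r)) (Conf n d False 0 (Entry e p s # st) ok) =
      Conf (Suc n2) d True (h a (up_val r)) st3 (ok \<and> (b1 \<and> b2))"
      unfolding whole by auto
    moreover have "thins (Suc n2) (?x # st) st3" using final drop by simp
    \<comment> \<open>The entry below was pushed no later than \<open>n\<close>, where this node
      begins, so the gap up to \<open>n1\<close> covers the whole first subtree.\<close>
    moreover have "\<not> length (moves r) \<le> length (moves l)"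
      using drop pos_st2(1) by (auto simp: thin_def n2_def n1_def)
    ultimately show ?thesis
      unfolding len using 1(3,4) 3(3,4)
      by (intro exI[of _ st3] exI[of _ "b1 \<and> b2"]) auto
  qed
qed

definition init :: "bool \<Rightarrow> conf" where
  "init ok = Conf 0 0 False 0 [Entry 0 0 0] ok"

fun conf_ok :: "conf \<Rightarrow> bool" where
  "conf_ok (Conf n d up r st ok) = ok"

lemma conf_ok_steps:
  "\<exists>b. conf_ok (steps (moves t) (init ok)) = (ok \<and> b) \<and> (all_ok t \<longrightarrow> b) \<and> (b \<longrightarrow> heavy_ok t)"
  using steps_moves[of 0 0 0 "[]" 0 0 t ok] by (auto simp: init_def)

end

text \<open>
  In \<open>sparse q st\<close>, the distance from \<open>q\<close> at least doubles from each entry to the next, because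
  no entry was thin when the last push took place.
\<close>

fun sparse :: "nat \<Rightarrow> entry list \<Rightarrow> bool" where
  "sparse q (x # y # st) \<longleftrightarrow> pos x < q \<and> q - pos x \<le> pos x - pos y \<and> sparse q (y # st)"
| "sparse q [x] \<longleftrightarrow> pos x < q"
| "sparse q [] \<longleftrightarrow> True"

lemma sparse_length:
  "sparse q (x # st) \<Longrightarrow> 2 ^ length st * (q - pos x) \<le> q - pos (last (x # st))"
proof (induction st arbitrary: x)
  case Nil
  then show ?case by simp
next
  case (Cons y st)
  then have "pos x < q" "q - pos x \<le> pos x - pos y" by auto
  then have "2 * (q - pos x) \<le> q - pos y" by arith
  then have "2 ^ length st * (2 * (q - pos x)) \<le> 2 ^ length st * (q - pos y)"
    by (intro mult_left_mono) auto
  also have "\<dots> \<le> q - pos (last (y # st))" using Cons by simp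
  finally show ?case by (simp add: algebra_simps)
qed

lemma power_length_sparse:
  assumes "sparse q st" "st \<noteq> []"
  shows "2 ^ (length st - 1) \<le> q"
proof -
  obtain x st' where st: "st = x # st'" using assms(2) by (cases st) auto
  have "1 \<le> q - pos x" using assms(1) by (cases st') (auto simp: st)
  then have "2 ^ length st' \<le> 2 ^ length st' * (q - pos x)" by simp
  also have "\<dots> \<le> q" using sparse_length[of q x st'] assms(1) by (simp add: st)
  finally show ?thesis by (simp add: st)
qed

text \<open>\<open>q - pos x \<le> pos x - pos y\<close> only gets easier when \<open>q\<close>
  decreases. A pop moves the reference point back in this way.\<close>

lemma sparse_mono: "sparse q st \<Longrightarrow> st = x # st' \<Longrightarrow> pos x < p \<Longrightarrow> p \<le> q \<Longrightarrow> sparse p st"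
  by (induction q st arbitrary: x st' rule: sparse.induct) auto

lemma sparse_tl: "sparse q (x # st) \<Longrightarrow> st \<noteq> [] \<Longrightarrow> sparse (pos x) st"
proof (cases st)
  case (Cons y st')
  assume "sparse q (x # st)"
  then have "pos y < pos x" "pos x \<le> q" "sparse q st" by (auto simp: Cons)
  then show ?thesis using sparse_mono Cons by blast
qed simp

lemma compact_nonempty: "st \<noteq> [] \<Longrightarrow> compact_stack n st \<noteq> []"
  by (induction n st rule: compact_stack.induct) (auto simp: Let_def)

lemma set_compact: "set (compact_stack n st) \<subseteq> set st"
  by (induction n st rule: compact_stack.induct) (auto simp: Let_def)

lemma length_compact: "length (compact_stack n st) \<le> length st"
  by (induction n st rule: compact_stack.induct) (auto simp: Let_def)

lemma sparse_compact: "\<forall>x\<in>set st. pos x < n \<Longrightarrow> sparse n (compact_stack n st)"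
proof (induction n st rule: compact_stack.induct)
  case (1 n x y st)
  obtain z st' where z: "compact_stack n (y # st) = z # st'"
    using compact_nonempty[of "y # st" n] by (cases "compact_stack n (y # st)") auto
  show ?case using 1 by (auto simp: Let_def z thin_def)
qed auto

lemma sparse_less: "sparse q st \<Longrightarrow> x \<in> set st \<Longrightarrow> pos x < q"
  by (induction q st rule: sparse.induct) auto

section \<open>Invariant and height of the stack\<close>

locale bounded_machine = tree_machine g h chk
  for g h :: "'b \<Rightarrow> nat \<Rightarrow> nat" and chk :: "'b \<Rightarrow> nat \<Rightarrow> bool" +
  fixes K :: nat
  assumes K_pos: "0 < K"
    and g_less: "s < K \<Longrightarrow> g a s < K"
    and h_less: "s < K \<Longrightarrow> h a s < K"
begin

text \<open>Distances are tested only at a push, so \<open>sparse\<close> is measured from the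
  position of the top entry and speaks of those below it. Strictness after an upward move ensures
  that the next push happens beyond all stored positions.\<close>

fun invar :: "conf \<Rightarrow> bool" where
  "invar (Conf n d up r st ok) \<longleftrightarrow>
     st \<noteq> [] \<and> (up \<longrightarrow> pos (hd st) < n) \<and> pos (hd st) \<le> n \<and> sparse (pos (hd st)) (tl st) \<and>
     (\<forall>x\<in>set st. depth x \<le> n \<and> state x < K) \<and> d \<le> n \<and> r < K"

lemma invar_init: "invar (init ok)"
  using K_pos by (simp add: init_def)

text \<open>The exponent leaves out the top entry, from which distances are measured, and the entry
  below it, whose distance is at least 1; each further entry doubles the distance.\<close>

lemma invar_length:
  assumes "invar (Conf n d up r st ok)"
  shows "2 ^ (length st - 2) \<le> Suc n"
proof (cases "tl st")
  case Nil
  then show ?thesis by (cases st) simp_all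
next
  case (Cons x st')
  then have "2 ^ (length (tl st) - 1) \<le> pos (hd st)"
    using assms power_length_sparse[of "pos (hd st)" "tl st"] by auto
  also have "\<dots> \<le> Suc n" using assms by simp
  finally show ?thesis by (simp add: numeral_2_eq_2)
qed

lemma upd_top_invar:
  assumes "st \<noteq> []" "\<forall>x\<in>set st. depth x \<le> n \<and> state x < K"
  shows "upd_top a st \<noteq> []" "pos (hd (upd_top a st)) = pos (hd st)" "tl (upd_top a st) = tl st"
    "\<forall>x\<in>set (upd_top a st). depth x \<le> n \<and> state x < K"
proof -
  obtain e p s st' where "st = Entry e p s # st'"
    using assms(1) by (metis entry.exhaust list.exhaust)
  then show "upd_top a st \<noteq> []" "pos (hd (upd_top a st)) = pos (hd st)"
    "tl (upd_top a st) = tl st" "\<forall>x\<in>set (upd_top a st). depth x \<le> n \<and> state x < K"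
    using assms(2) g_less by auto
qed

text \<open>Arbitrary moves are covered, also unbalanced ones: the guard
  \<open>tl st \<noteq> []\<close> keeps the sentinel, and \<open>d - 1\<close> is truncated at
  0.\<close>

lemma invar_step:
  assumes "invar c"
  shows "invar (step m c)"
proof (cases c)
  case c: (Conf n d up r st ok)
  have lt: "\<forall>x\<in>set st. pos x < n" if "up"
  proof
    fix x assume "x \<in> set st"
    then have "x = hd st \<or> x \<in> set (tl st)" by (cases st) auto
    then show "pos x < n"
      using that assms sparse_less[of "pos (hd st)" "tl st" x] by (auto simp: c)
  qed
  show ?thesis
  proof (cases m)
    case (Down a)
    show ?thesis
    proof (cases up)
      case True
      have 1: "sparse n (compact_stack n st)" using sparse_compact lt[OF True] by simp
      have "\<forall>x\<in>set (compact_stack n st). depth x \<le> Suc n \<and> state x < K"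
        using assms set_compact[of n st] by (fastforce simp: c)
      then show ?thesis
        using 1 assms True g_less K_pos by (simp add: c Down)
    next
      case False
      then show ?thesis
        using assms upd_top_invar[of st "Suc n" a] by (fastforce simp: c Down)
    qed
  next
    case (Up a)
    show ?thesis
    proof (cases "up \<and> depth (hd st) = d \<and> tl st \<noteq> []")
      case True
      then obtain x y st' where st: "st = x # y # st'" by (metis list.collapse list.sel(2))
      have "pos y < n" using lt True by (simp add: st)
      moreover have "sparse (pos y) st'"
        using assms sparse_tl[of "pos x" y st'] by (cases st') (auto simp: c st)
      ultimately show ?thesis using True assms h_less by (auto simp: c Up st le_SucI)
    next
      case False
      then have "\<exists>ok'. step m c = Conf (Suc n) (d - 1) True (h a r) st ok'"
        by (auto simp: c Up)
      then obtain ok' where s: "step m c = Conf (Suc n) (d - 1) True (h a r) st ok'" by blast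
      show ?thesis unfolding s using assms h_less by (auto simp: c le_SucI)
    qed
  qed
qed

end

section \<open>Validity from the two passes\<close>

fun full_tree :: "'a tree \<Rightarrow> 'a option ftree" where
  "full_tree Leaf = FLeaf None"
| "full_tree (Node l a r) =
     (if l = Leaf \<and> r = Leaf then FLeaf (Some a) else FNode (Some a) (full_tree l) (full_tree r))"

fun mirror_ftree :: "'b ftree \<Rightarrow> 'b ftree" where
  "mirror_ftree (FLeaf a) = FLeaf a"
| "mirror_ftree (FNode a l r) = FNode a (mirror_ftree r) (mirror_ftree l)"

lemma length_moves_mirror [simp]: "length (moves (mirror_ftree t)) = length (moves t)"
  by (induction t) auto

primrec forward_tag :: "'b move \<Rightarrow> 'b tag" where
  "forward_tag (Down a) = Open a"
| "forward_tag (Up a) = Close a"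

primrec backward_tag :: "'b move \<Rightarrow> 'b tag" where
  "backward_tag (Down a) = Close a"
| "backward_tag (Up a) = Open a"

lemma xml_add_bot: "xml (add_bot t) = map forward_tag (moves (full_tree t))"
  by (induction t) auto

text \<open>Reversal exchanges the order of the subtrees and at the same time the roles of the
  tags.\<close>

lemma rev_xml_add_bot: "rev (xml (add_bot t)) = map backward_tag (moves (mirror_ftree (full_tree t)))"
  by (induction t) auto

text \<open>Two moves for each of the at most \<open>2 * size t + 1\<close> nodes of the completed
  binary tree.\<close>

lemma length_moves_full_tree: "length (moves (full_tree t)) \<le> 4 * size t + 2"
  by (induction t) auto

lemma size_fcns_forest: "size (fcns_forest ts) = sum_list (map num_nodes ts)"
  by (induction ts rule: fcns_forest.induct) auto

lemma size_fcns: "size (fcns t) = num_nodes t"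
  unfolding fcns_def size_fcns_forest by simp

fun spine :: "'a tree \<Rightarrow> 'a list" where
  "spine Leaf = []"
| "spine (Node l a r) = a # spine r"

fun fcns_valid :: "'a dtd \<Rightarrow> 'a tree \<Rightarrow> bool" where
  "fcns_valid D Leaf = True"
| "fcns_valid D (Node l a r) \<longleftrightarrow> spine l \<in> lang (D a) \<and> fcns_valid D l \<and> fcns_valid D r"

lemma spine_fcns_forest: "spine (fcns_forest ts) = map label ts"
  by (induction ts rule: fcns_forest.induct) auto

lemma fcns_valid_forest: "fcns_valid D (fcns_forest ts) = list_all (valid D) ts"
  by (induction ts rule: fcns_forest.induct) (auto simp: spine_fcns_forest)

lemma fcns_valid: "fcns_valid D (fcns t) = valid D t"
  by (simp add: fcns_def fcns_valid_forest)

text \<open>A missing child contributes no letter to a word of children and has no content model of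
  its own.\<close>

fun lift_step :: "('a \<Rightarrow> nat \<Rightarrow> nat) \<Rightarrow> 'a option \<Rightarrow> nat \<Rightarrow> nat" where
  "lift_step \<delta> None s = s"
| "lift_step \<delta> (Some a) s = \<delta> a s"

fun lift_check :: "('a \<Rightarrow> nat set) \<Rightarrow> 'a option \<Rightarrow> nat \<Rightarrow> bool" where
  "lift_check F None s = True"
| "lift_check F (Some a) s = (s \<in> F a)"

locale two_pass =
  fixes D :: "'a dtd" and \<delta>f \<delta>b :: "'a \<Rightarrow> nat \<Rightarrow> nat" and Ff Fb :: "'a \<Rightarrow> nat set"
  assumes forward: "foldr \<delta>f w 0 \<in> Ff a \<longleftrightarrow> w \<in> lang (D a)"
    and backward: "fold \<delta>b w 0 \<in> Fb a \<longleftrightarrow> w \<in> lang (D a)"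
begin

text \<open>
  Forwards, the register accumulates the labels of a spine from right to left as its nodes are
  left, and the stack stores it unchanged.  Backwards, the nodes of a spine are entered in a row
  from left to right, so the top entry of the stack can follow the automaton directly.
\<close>

sublocale f: tree_machine "\<lambda>_ s. s" "lift_step \<delta>f" "lift_check Ff" .
sublocale b: tree_machine "lift_step \<delta>b" "\<lambda>_ _. 0" "lift_check Fb" .

lemma forward_val: "f.up_val (full_tree t) = foldr \<delta>f (spine t) 0"
  by (induction t) auto

lemma forward_down_val: "f.down_val t s = s"
  by (induction t arbitrary: s) auto

text \<open>So the backward pass pushes the initial state of its automaton.\<close>

lemma backward_up_val: "b.up_val t = 0"
  by (cases t) auto

lemma backward_val: "b.down_val (mirror_ftree (full_tree t)) s = fold \<delta>b (spine t) s"
  by (induction t arbitrary: s) auto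

lemma forward_Nil: "0 \<in> Ff a \<longleftrightarrow> [] \<in> lang (D a)"
  using forward[of "[]" a] by simp

lemma backward_Nil: "0 \<in> Fb a \<longleftrightarrow> [] \<in> lang (D a)"
  using backward[of "[]" a] by simp

lemma forward_all_ok: "fcns_valid D t \<Longrightarrow> f.all_ok (full_tree t)"
  by (induction t) (auto simp: forward_Nil forward_val forward_down_val forward)

lemma backward_all_ok: "fcns_valid D t \<Longrightarrow> b.all_ok (mirror_ftree (full_tree t))"
  by (induction t) (auto simp: backward_Nil backward_val backward_up_val backward)

text \<open>Reversing the stream swaps the two subtrees of a node, so one of the passes checks it.\<close>

lemma heavy_ok_both:
  "f.heavy_ok (full_tree t) \<Longrightarrow> b.heavy_ok (mirror_ftree (full_tree t)) \<Longrightarrow> fcns_valid D t"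
proof (induction t)
  case Leaf
  then show ?case by simp
next
  case (Node l a r)
  show ?case
  proof (cases "l = Leaf \<and> r = Leaf")
    case True
    with Node.prems show ?thesis by (simp add: forward_Nil)
  next
    case False
    then have "spine l \<in> lang (D a)"
      using Node.prems
      by (cases "length (moves (full_tree r)) \<le> length (moves (full_tree l))")
        (auto simp: forward_val forward_down_val forward backward_val backward_up_val backward
          split: if_splits)
    then show ?thesis using Node False by auto
  qed
qed

text \<open>For a valid tree every check succeeds, whatever is discarded; conversely, two successful
  passes together have checked every node. The first verdict enters the second pass as its initial
  \<open>ok\<close>.\<close>

lemma two_passes:
  "b.conf_ok (b.steps (moves (mirror_ftree (full_tree t)))
     (b.init (f.conf_ok (f.steps (moves (full_tree t)) (f.init True))))) = fcns_valid D t"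
proof -
  let ?t = "full_tree t" and ?t' = "mirror_ftree (full_tree t)"
  obtain b1 where 1: "f.conf_ok (f.steps (moves ?t) (f.init True)) = b1"
    "f.all_ok ?t \<longrightarrow> b1" "b1 \<longrightarrow> f.heavy_ok ?t"
    using f.conf_ok_steps[of ?t True] by (metis (full_types))
  obtain b2 where 2: "b.conf_ok (b.steps (moves ?t') (b.init b1)) = (b1 \<and> b2)"
    "b.all_ok ?t' \<longrightarrow> b2" "b2 \<longrightarrow> b.heavy_ok ?t'"
    using b.conf_ok_steps[of ?t' b1] by blast
  show ?thesis
    unfolding 1(1) 2(1) using 1(2,3) 2(2,3) forward_all_ok backward_all_ok heavy_ok_both by blast
qed

end

section \<open>Implementation of the machine\<close>

definition runs :: "nat \<Rightarrow> nat \<Rightarrow> 'i option \<Rightarrow> 'i com \<Rightarrow> nat \<Rightarrow> mem \<Rightarrow> mem \<Rightarrow> bool" where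
  "runs m V x c T \<sigma> \<sigma>' \<longleftrightarrow> (\<exists>k\<le>T. exec m V x c \<sigma> k \<sigma>')"

lemma runs_Skip: "1 \<le> T \<Longrightarrow> runs m V x Skip T \<sigma> \<sigma>"
  unfolding runs_def by (blast intro: exec.Skip)

lemma runs_Seq:
  "runs m V x c1 T1 \<sigma> \<sigma>1 \<Longrightarrow> runs m V x c2 T2 \<sigma>1 \<sigma>2 \<Longrightarrow> T1 + T2 \<le> T \<Longrightarrow>
    runs m V x (Seq c1 c2) T \<sigma> \<sigma>2"
  unfolding runs_def by (meson add_mono exec.Seq order_trans)

lemma runs_Cond:
  assumes "bsafe m V \<sigma> b" "runs m V x (if bval x \<sigma> b then c1 else c2) T1 \<sigma> \<sigma>'"
    "Suc (bcost b + T1) \<le> T"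
  shows "runs m V x (Cond b c1 c2) T \<sigma> \<sigma>'"
proof -
  obtain k where k: "k \<le> T1" "exec m V x (if bval x \<sigma> b then c1 else c2) \<sigma> k \<sigma>'"
    using assms(2) by (auto simp: runs_def)
  then have "exec m V x (Cond b c1 c2) \<sigma> (Suc (bcost b + k)) \<sigma>'"
    using assms(1) by (cases "bval x \<sigma> b") (auto intro: exec.CondTrue exec.CondFalse)
  moreover have "Suc (bcost b + k) \<le> T" using k assms(3) by simp
  ultimately show ?thesis unfolding runs_def by blast
qed

lemma runs_LoopFalse:
  "bsafe m V \<sigma> b \<Longrightarrow> \<not> bval x \<sigma> b \<Longrightarrow> Suc (bcost b) \<le> T \<Longrightarrow> runs m V x (Loop b c) T \<sigma> \<sigma>"
  unfolding runs_def by (blast intro: exec.LoopFalse)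

lemma runs_LoopTrue:
  assumes "bsafe m V \<sigma> b" "bval x \<sigma> b" "runs m V x c T1 \<sigma> \<sigma>1" "runs m V x (Loop b c) T2 \<sigma>1 \<sigma>2"
    "Suc (bcost b + T1 + T2) \<le> T"
  shows "runs m V x (Loop b c) T \<sigma> \<sigma>2"
proof -
  obtain k1 k2 where k: "k1 \<le> T1" "exec m V x c \<sigma> k1 \<sigma>1" "k2 \<le> T2" "exec m V x (Loop b c) \<sigma>1 k2 \<sigma>2"
    using assms(3,4) by (auto simp: runs_def)
  then have "exec m V x (Loop b c) \<sigma> (Suc (bcost b + k1 + k2)) \<sigma>2"
    using assms(1,2) by (auto intro: exec.LoopTrue)
  moreover have "Suc (bcost b + k1 + k2) \<le> T" using k assms(5) by simp
  ultimately show ?thesis unfolding runs_def by blast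
qed

text \<open>On loops, \<open>result\<close> and \<open>time\<close> are junk; \<open>safe\<close> excludes them.\<close>

primrec result :: "'i option \<Rightarrow> 'i com \<Rightarrow> mem \<Rightarrow> mem" where
  "result x Skip \<sigma> = \<sigma>"
| "result x (Store e1 e2) \<sigma> = \<sigma>(aval \<sigma> e1 := aval \<sigma> e2)"
| "result x (Seq c1 c2) \<sigma> = result x c2 (result x c1 \<sigma>)"
| "result x (Cond b c1 c2) \<sigma> = (if bval x \<sigma> b then result x c1 \<sigma> else result x c2 \<sigma>)"
| "result x (Loop b c) \<sigma> = \<sigma>"

primrec safe :: "nat \<Rightarrow> nat \<Rightarrow> 'i option \<Rightarrow> 'i com \<Rightarrow> mem \<Rightarrow> bool" where
  "safe m V x Skip \<sigma> = True"
| "safe m V x (Store e1 e2) \<sigma> \<longleftrightarrow> asafe m V \<sigma> e1 \<and> asafe m V \<sigma> e2 \<and> aval \<sigma> e1 < m"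
| "safe m V x (Seq c1 c2) \<sigma> \<longleftrightarrow> safe m V x c1 \<sigma> \<and> safe m V x c2 (result x c1 \<sigma>)"
| "safe m V x (Cond b c1 c2) \<sigma> \<longleftrightarrow>
     bsafe m V \<sigma> b \<and> (if bval x \<sigma> b then safe m V x c1 \<sigma> else safe m V x c2 \<sigma>)"
| "safe m V x (Loop b c) \<sigma> = False"

primrec time :: "'i com \<Rightarrow> nat" where
  "time Skip = 1"
| "time (Store e1 e2) = Suc (acost e1 + acost e2)"
| "time (Seq c1 c2) = time c1 + time c2"
| "time (Cond b c1 c2) = Suc (bcost b + max (time c1) (time c2))"
| "time (Loop b c) = 0"

lemma runs_result: "safe m V x c \<sigma> \<Longrightarrow> time c \<le> T \<Longrightarrow> runs m V x c T \<sigma> (result x c \<sigma>)"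
proof (induction c arbitrary: \<sigma> T)
  case Skip
  then show ?case by (simp add: runs_Skip)
next
  case (Store e1 e2)
  then show ?case unfolding runs_def by (auto intro!: exI exec.Store)
next
  case (Seq c1 c2)
  then show ?case by (auto intro!: runs_Seq)
next
  case (Cond b c1 c2)
  then show ?case
    by (auto intro!: runs_Cond[where ?T1.0 = "max (time c1) (time c2)"])
qed simp

text \<open>
  Word \<open>0\<close> holds the answer, \<open>1\<close> whether some check has failed, \<open>2\<close> to \<open>6\<close> the position, the depth,
  the direction of the last move, the register and the index of the top entry; \<open>7\<close> and \<open>8\<close> are the
  reading and writing index during compaction.  Entry \<open>i\<close> occupies the words from \<open>10 + 3 * i\<close> on.
\<close>

abbreviation word :: "nat \<Rightarrow> aexp" where
  "word i \<equiv> Load (Const i)"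

abbreviation field :: "nat \<Rightarrow> nat \<Rightarrow> aexp" where
  "field q i \<equiv> Arith Add (Const q) (Arith Mul (Const 3) (word i))"

abbreviation incr :: "nat \<Rightarrow> 'i com" where
  "incr i \<equiv> Store (Const i) (Arith Add (word i) (Const 1))"

abbreviation decr :: "nat \<Rightarrow> 'i com" where
  "decr i \<equiv> Store (Const i) (Arith Sub (word i) (Const 1))"

definition entry :: "mem \<Rightarrow> nat \<Rightarrow> entry" where
  "entry \<sigma> i = Entry (\<sigma> (10 + 3 * i)) (\<sigma> (11 + 3 * i)) (\<sigma> (12 + 3 * i))"

definition holds_stack :: "mem \<Rightarrow> entry list \<Rightarrow> bool" where
  "holds_stack \<sigma> st \<longleftrightarrow> (\<forall>i<length st. entry \<sigma> i = rev st ! i)"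

lemma entry_upd_low [simp]: "a < 10 \<Longrightarrow> entry (\<sigma>(a := v)) i = entry \<sigma> i"
  by (simp add: entry_def)

lemma entry_upd [simp]:
  "entry (\<sigma>(10 + 3 * j := v)) i = (if i = j then Entry v (pos (entry \<sigma> i)) (state (entry \<sigma> i)) else entry \<sigma> i)"
  "entry (\<sigma>(11 + 3 * j := v)) i = (if i = j then Entry (depth (entry \<sigma> i)) v (state (entry \<sigma> i)) else entry \<sigma> i)"
  "entry (\<sigma>(12 + 3 * j := v)) i = (if i = j then Entry (depth (entry \<sigma> i)) (pos (entry \<sigma> i)) v else entry \<sigma> i)"
  unfolding entry_def by (auto; presburger)+

lemma entry_fields:
  "\<sigma> (10 + 3 * i) = depth (entry \<sigma> i)" "\<sigma> (11 + 3 * i) = pos (entry \<sigma> i)"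
  "\<sigma> (12 + 3 * i) = state (entry \<sigma> i)"
  by (simp_all add: entry_def)

lemma holds_stack_Cons:
  "holds_stack \<sigma> (x # st) \<longleftrightarrow> entry \<sigma> (length st) = x \<and> holds_stack \<sigma> st"
  by (auto simp: holds_stack_def nth_append less_Suc_eq)

lemma holds_stack_upd_low [simp]: "a < 10 \<Longrightarrow> holds_stack (\<sigma>(a := v)) st = holds_stack \<sigma> st"
  by (simp add: holds_stack_def)

lemma holds_stack_upd [simp]:
  assumes "length st \<le> j"
  shows "holds_stack (\<sigma>(10 + 3 * j := v)) st = holds_stack \<sigma> st"
    and "holds_stack (\<sigma>(11 + 3 * j := v)) st = holds_stack \<sigma> st"
    and "holds_stack (\<sigma>(12 + 3 * j := v)) st = holds_stack \<sigma> st"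
  using assms by (auto simp: holds_stack_def)

section \<open>Compaction in place\<close>

definition compact_body :: "'i com" where
  "compact_body = Seq (incr 7)
     (Cond (Less (Arith Sub (Load (field 11 7)) (Load (field 11 8))) (Arith Sub (word 2) (Load (field 11 7))))
       Skip
       (Seq (incr 8)
         (Seq (Store (field 10 8) (Load (field 10 7)))
           (Seq (Store (field 11 8) (Load (field 11 7)))
             (Store (field 12 8) (Load (field 12 7)))))))"

text \<open>Both indices start at the sentinel, which is always kept. The memory holds the bottom
  entry first, so the sweep decides the entries in the same order as the recursion of
  \<open>compact_stack\<close>, and writing never overtakes reading.\<close>

definition compact_prog :: "'i com" where
  "compact_prog = Seq (Store (Const 7) (Const 0)) (Seq (Store (Const 8) (Const 0))
     (Seq (Loop (Less (word 7) (word 6)) compact_body) (Store (Const 6) (word 8))))"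

lemma field_neq [simp]:
  "10 + 3 * i \<noteq> 11 + 3 * (j::nat)" "11 + 3 * i \<noteq> 10 + 3 * (j::nat)" "10 + 3 * i \<noteq> 12 + 3 * (j::nat)"
  "12 + 3 * i \<noteq> 10 + 3 * (j::nat)" "11 + 3 * i \<noteq> 12 + 3 * (j::nat)" "12 + 3 * i \<noteq> 11 + 3 * (j::nat)"
  by presburger+

lemma compact_body_result:
  assumes "Suc (\<sigma> 7) = i" "Suc (\<sigma> 8) = j" "entry \<sigma> i = x" "entry \<sigma> (\<sigma> 8) = y" "j \<le> i"
    and "12 + 3 * i < m" "m \<le> V" "\<sigma> 2 = n" "n \<le> V" "pos x \<le> n" "pos y \<le> n"
    and "depth x \<le> V" "state x \<le> V"
  shows "safe m V l compact_body \<sigma>"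
    and "result l compact_body \<sigma> = (if thin n x y then \<sigma>(7 := i)
      else \<sigma>(7 := i, 8 := j, 10 + 3 * j := depth x, 11 + 3 * j := pos x, 12 + 3 * j := state x))"
proof -
  have x: "\<sigma> (10 + 3 * i) = depth x" "\<sigma> (11 + 3 * i) = pos x" "\<sigma> (12 + 3 * i) = state x"
    using assms(3) by (auto simp: entry_def)
  have y: "\<sigma> (11 + 3 * \<sigma> 8) = pos y" using assms(4) by (auto simp: entry_def)
  have le: "\<sigma> 8 \<le> i" "j \<le> V" "i \<le> V" "pos x - pos y \<le> V" "n - pos x \<le> V"
    using assms by auto
  show "safe m V l compact_body \<sigma>"
    using assms(5-) le
    by (simp add: compact_body_def assms(1,2) x y del: mult_Suc_right)
  show "result l compact_body \<sigma> = (if thin n x y then \<sigma>(7 := i)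
      else \<sigma>(7 := i, 8 := j, 10 + 3 * j := depth x, 11 + 3 * j := pos x, 12 + 3 * j := state x))"
    using assms(5-)
    by (simp add: compact_body_def assms(1,2) x y thin_def)
qed

lemma compact_Cons:
  "st \<noteq> [] \<Longrightarrow> compact_stack n (x # st) =
     (if thin n x (hd (compact_stack n st)) then compact_stack n st else x # compact_stack n st)"
  by (cases st) (auto simp: Let_def)

text \<open>The part of the stack processed so far has been compacted in place; the rest is untouched.\<close>

definition compact_inv :: "mem \<Rightarrow> entry list \<Rightarrow> nat \<Rightarrow> mem \<Rightarrow> nat \<Rightarrow> bool" where
  "compact_inv \<sigma>0 st n \<sigma> i \<longleftrightarrow>
     (let st' = compact_stack n (drop (length st - Suc i) st) in
       i < length st \<and> \<sigma> 7 = i \<and> Suc (\<sigma> 8) = length st' \<and> holds_stack \<sigma> st' \<and>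
       (\<forall>a<10. a \<noteq> 7 \<and> a \<noteq> 8 \<longrightarrow> \<sigma> a = \<sigma>0 a) \<and>
       (\<forall>i'. i < i' \<and> i' < length st \<longrightarrow> entry \<sigma> i' = rev st ! i'))"

lemma compact_body_correct:
  assumes inv: "compact_inv \<sigma>0 st n \<sigma> i" and i: "Suc i < length st"
    and pos: "\<forall>x\<in>set st. pos x \<le> n \<and> depth x \<le> V \<and> state x \<le> V"
    and V: "n \<le> V" "m \<le> V" "13 + 3 * length st \<le> m" and n: "\<sigma>0 2 = n"
  shows "safe m V l compact_body \<sigma>" "compact_inv \<sigma>0 st n (result l compact_body \<sigma>) (Suc i)"
proof -
  define zs where "zs = drop (length st - Suc i) st"
  define x where "x = rev st ! Suc i"
  have rest: "drop (length st - Suc (Suc i)) st = x # zs"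
  proof -
    have "length st - Suc i = Suc (length st - Suc (Suc i))" using i by simp
    moreover have "x = st ! (length st - Suc (Suc i))" using i by (simp add: x_def rev_nth)
    ultimately show ?thesis unfolding zs_def using i by (simp add: Cons_nth_drop_Suc)
  qed
  have "zs \<noteq> []" using i by (simp add: zs_def)
  define st' where "st' = compact_stack n zs"
  have "length zs = Suc i" using i by (simp add: zs_def)
  then have len: "length st' \<le> Suc i" using length_compact[of n zs] by (simp add: st'_def)
  obtain y ys where y: "st' = y # ys"
    using compact_nonempty[OF \<open>zs \<noteq> []\<close>] by (metis list.exhaust st'_def)
  have I: "\<sigma> 7 = i" "\<sigma> 8 = length ys" "entry \<sigma> (length ys) = y" "holds_stack \<sigma> ys"
    "\<sigma> 2 = n" "\<forall>a<10. a \<noteq> 7 \<and> a \<noteq> 8 \<longrightarrow> \<sigma> a = \<sigma>0 a"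
    "\<forall>i'. i < i' \<and> i' < length st \<longrightarrow> entry \<sigma> i' = rev st ! i'"
    using inv n by (auto simp: compact_inv_def zs_def[symmetric] st'_def[symmetric] y holds_stack_Cons)
  have x: "entry \<sigma> (Suc i) = x" using I(7) i by (simp add: x_def)
  have "x \<in> set st" using i by (simp add: x_def rev_nth)
  have "y \<in> set st"
    using set_compact[of n zs] set_drop_subset[of _ st] y by (force simp: st'_def zs_def)
  have bounds: "pos x \<le> n" "depth x \<le> V" "state x \<le> V" "pos y \<le> n"
    using pos \<open>x \<in> set st\<close> \<open>y \<in> set st\<close> by auto
  have lys: "length ys \<le> i" using len by (simp add: y)
  have inv': "compact_inv \<sigma>0 st n (if thin n x y then \<sigma>(7 := Suc i)
      else \<sigma>(7 := Suc i, 8 := k, 10 + 3 * k := depth x, 11 + 3 * k := pos x, 12 + 3 * k := state x))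
      (Suc i)" if k: "k = Suc (length ys)" for k
  proof -
    have kl: "length ys < k" "length ys \<noteq> k" "k \<le> Suc i" using k lys by auto
    show ?thesis
    proof (cases "thin n x y")
      case True
      have "compact_stack n (x # zs) = y # ys"
        using True \<open>zs \<noteq> []\<close> by (simp add: compact_Cons st'_def[symmetric] y)
      then show ?thesis
        using True I i by (simp add: compact_inv_def rest holds_stack_Cons)
    next
      case False
      have "compact_stack n (x # zs) = x # y # ys"
        using False \<open>zs \<noteq> []\<close> by (simp add: compact_Cons st'_def[symmetric] y)
      then show ?thesis
        using False I i lys kl by (simp add: compact_inv_def rest holds_stack_Cons k[symmetric])
    qed
  qed
  show "safe m V l compact_body \<sigma>" "compact_inv \<sigma>0 st n (result l compact_body \<sigma>) (Suc i)"
    using compact_body_result[of \<sigma> "Suc i" "Suc (length ys)" x y m V n l] I x lys bounds V i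
      inv'[OF refl]
    by simp_all
qed

text \<open>6 is the time of one loop test. The time of the body is the same for all alphabets, so
  \<open>unit\<close> stands for any of them.\<close>

definition compact_cost :: nat where
  "compact_cost = 6 + time (compact_body :: unit com)"

lemma time_compact_body: "time compact_body = compact_cost - 6"
  by (simp add: compact_cost_def compact_body_def)

text \<open>The summand 10 pays for the last, failing test.\<close>

lemma compact_loop:
  assumes "compact_inv \<sigma>0 st n \<sigma> i" "\<sigma>0 6 = length st - 1"
    and pos: "\<forall>x\<in>set st. pos x \<le> n \<and> depth x \<le> V \<and> state x \<le> V"
    and V: "n \<le> V" "m \<le> V" "13 + 3 * length st \<le> m" and n: "\<sigma>0 2 = n"
  shows "\<exists>\<sigma>'. runs m V l (Loop (Less (word 7) (word 6)) compact_body) (compact_cost * (length st - i) + 10) \<sigma> \<sigma>' \<and>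
    compact_inv \<sigma>0 st n \<sigma>' (length st - 1)"
  using assms(1)
proof (induction "length st - i" arbitrary: \<sigma> i)
  case 0
  then show ?case by (simp add: compact_inv_def Let_def)
next
  case (Suc k)
  from Suc.prems have i: "\<sigma> 7 = i" "\<sigma> 6 = length st - 1" "i < length st"
    using assms(2) by (auto simp: compact_inv_def Let_def)
  have safe: "bsafe m V \<sigma> (Less (word 7) (word 6))" using V by simp
  show ?case
  proof (cases "Suc i < length st")
    case True
    note body = compact_body_correct[OF Suc.prems True pos V n, of l]
    have "k = length st - Suc i" using Suc.hyps(2) by simp
    from Suc.hyps(1)[OF this body(2)] obtain \<sigma>' where
      IH: "runs m V l (Loop (Less (word 7) (word 6)) compact_body) (compact_cost * (length st - Suc i) + 10)
        (result l compact_body \<sigma>) \<sigma>'" "compact_inv \<sigma>0 st n \<sigma>' (length st - 1)" by blast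
    have "length st - i = Suc (length st - Suc i)" using i by simp
    then have "Suc (bcost (Less (word 7) (word 6)) + (compact_cost - 6) + (compact_cost * (length st - Suc i) + 10))
      \<le> compact_cost * (length st - i) + 10"
      by (simp add: compact_cost_def)
    moreover have "runs m V l compact_body (compact_cost - 6) \<sigma> (result l compact_body \<sigma>)"
      using runs_result[OF body(1)] by (simp add: time_compact_body)
    moreover have "bval l \<sigma> (Less (word 7) (word 6))" using i True by simp
    ultimately show ?thesis
      using runs_LoopTrue[OF safe _ _ IH(1)] IH(2) by blast
  next
    case False
    then have "runs m V l (Loop (Less (word 7) (word 6)) compact_body) (compact_cost * (length st - i) + 10) \<sigma> \<sigma>"
      using i by (intro runs_LoopFalse[OF safe]) auto
    moreover have "i = length st - 1" using False i by simp
    ultimately show ?thesis using Suc.prems by blast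
  qed
qed

lemma compact_prog_correct:
  assumes st: "st \<noteq> []" "holds_stack \<sigma> st" "\<sigma> 6 = length st - 1"
    and pos: "\<forall>x\<in>set st. pos x \<le> n \<and> depth x \<le> V \<and> state x \<le> V"
    and V: "n \<le> V" "m \<le> V" "13 + 3 * length st \<le> m" and n: "\<sigma> 2 = n"
  obtains \<sigma>' where "runs m V l compact_prog (compact_cost * length st + 20) \<sigma> \<sigma>'"
    "holds_stack \<sigma>' (compact_stack n st)" "\<sigma>' 6 = length (compact_stack n st) - 1"
    "\<And>a. a < 6 \<Longrightarrow> \<sigma>' a = \<sigma> a"
proof -
  let ?\<sigma>1 = "\<sigma>(7 := 0, 8 := 0)"
  let ?loop = "Loop (Less (word 7) (word 6)) compact_body :: 'a com"
  have "compact_stack n [last st] = [last st]" by simp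
  moreover have "drop (length st - 1) st = [last st]"
    using st(1) by (metis append_butlast_last_id append_eq_conv_conj length_butlast)
  moreover have "entry \<sigma> 0 = last st"
    using st(1,2) by (simp add: holds_stack_def rev_nth last_conv_nth)
  ultimately have "compact_inv ?\<sigma>1 st n ?\<sigma>1 0"
    using st by (auto simp: compact_inv_def holds_stack_Cons holds_stack_def)
  from compact_loop[OF this _ pos V] n st obtain \<sigma>2 where
    \<sigma>2: "runs m V l ?loop (compact_cost * length st + 10) ?\<sigma>1 \<sigma>2"
      "compact_inv ?\<sigma>1 st n \<sigma>2 (length st - 1)" by auto
  have I: "Suc (\<sigma>2 8) = length (compact_stack n st)" "holds_stack \<sigma>2 (compact_stack n st)"
    "\<forall>a<10. a \<noteq> 7 \<and> a \<noteq> 8 \<longrightarrow> \<sigma>2 a = ?\<sigma>1 a"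
    using \<sigma>2(2) st(1) by (auto simp: compact_inv_def Let_def)
  have small: "13 \<le> m" "13 \<le> V" using V by simp_all
  have "runs m V l (Store (Const 7) (Const 0)) 3 \<sigma> (\<sigma>(7 := 0))"
    using runs_result[of m V l "Store (Const 7) (Const 0)" \<sigma> 3] small by simp
  moreover have "runs m V l (Store (Const 8) (Const 0)) 3 (\<sigma>(7 := 0)) ?\<sigma>1"
    using runs_result[of m V l "Store (Const 8) (Const 0)" "\<sigma>(7 := 0)" 3] small by simp
  moreover have "runs m V l (Store (Const 6) (word 8)) 4 \<sigma>2 (\<sigma>2(6 := \<sigma>2 8))"
    using runs_result[of m V l "Store (Const 6) (word 8)" \<sigma>2 4] small by simp
  ultimately have "runs m V l compact_prog (3 + (3 + ((compact_cost * length st + 10) + 4))) \<sigma> (\<sigma>2(6 := \<sigma>2 8))"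
    unfolding compact_prog_def by (intro runs_Seq[OF _ runs_Seq[OF _ runs_Seq[OF \<sigma>2(1)]]]) auto
  then have "runs m V l compact_prog (compact_cost * length st + 20) \<sigma> (\<sigma>2(6 := \<sigma>2 8))"
    by (simp add: add.commute)
  then show ?thesis
    using that[of "\<sigma>2(6 := \<sigma>2 8)"] I by (auto simp: holds_stack_upd_low)
qed

section \<open>Commands for single moves and for the end of a pass\<close>

context bounded_machine
begin

text \<open>A finite function becomes a cascade of comparisons whose length depends on the DTD only.
  The tests are nested, so \<open>dst\<close> may be the very word that \<open>src\<close>
  reads.\<close>

definition table :: "(nat \<Rightarrow> nat) \<Rightarrow> aexp \<Rightarrow> aexp \<Rightarrow> 'i com" where
  "table f src dst = foldr (\<lambda>s c. Cond (Equal src (Const s)) (Store dst (Const (f s))) c) [0..<K] Skip"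

lemma table_correct:
  assumes "asafe m V \<sigma> src" "aval \<sigma> src < K" "asafe m V \<sigma> dst" "aval \<sigma> dst < m"
    and V: "K \<le> V" "\<And>s. s < K \<Longrightarrow> f s \<le> V"
  shows "safe m V l (table f src dst) \<sigma>"
    "result l (table f src dst) \<sigma> = \<sigma>(aval \<sigma> dst := f (aval \<sigma> src))"
proof -
  let ?c = "\<lambda>ss. foldr (\<lambda>s c. Cond (Equal src (Const s)) (Store dst (Const (f s))) c) ss Skip"
  have "safe m V l (?c ss) \<sigma> \<and>
    (aval \<sigma> src \<in> set ss \<longrightarrow> result l (?c ss) \<sigma> = \<sigma>(aval \<sigma> dst := f (aval \<sigma> src)))"
    if "\<forall>s\<in>set ss. s < K" for ss
    using that assms by (induction ss) auto
  from this[of "[0..<K]"] assms(2)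
  show "safe m V l (table f src dst) \<sigma>"
    "result l (table f src dst) \<sigma> = \<sigma>(aval \<sigma> dst := f (aval \<sigma> src))"
    by (auto simp: table_def)
qed

fun represents :: "mem \<Rightarrow> conf \<Rightarrow> bool" where
  "represents \<sigma> (Conf n d up r st ok) \<longleftrightarrow>
     \<sigma> 1 = of_bool (\<not> ok) \<and> \<sigma> 2 = n \<and> \<sigma> 3 = d \<and> \<sigma> 4 = of_bool up \<and> \<sigma> 5 = r \<and>
     Suc (\<sigma> 6) = length st \<and> holds_stack \<sigma> st"

definition push :: "'i com" where
  "push = Seq (incr 6) (Seq (Store (field 10 6) (word 3)) (Seq (Store (field 11 6) (word 2))
     (Seq (Store (field 12 6) (word 5)) (Store (Const 5) (Const 0)))))"

definition down_tail :: "'b \<Rightarrow> 'i com" where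
  "down_tail a = Seq (table (g a) (Load (field 12 6)) (field 12 6))
     (Seq (incr 2) (Seq (incr 3) (Store (Const 4) (Const 0))))"

definition down_prog :: "'b \<Rightarrow> 'i com" where
  "down_prog a = Seq (Cond (Equal (word 4) (Const 1)) (Seq compact_prog push) Skip) (down_tail a)"

text \<open>Word 1 is written only while it is 0, so a failure is never revoked.\<close>

definition check :: "'b \<Rightarrow> aexp \<Rightarrow> 'i com" where
  "check a src =
     Cond (Equal (word 1) (Const 0)) (table (\<lambda>s. of_bool (\<not> chk a s)) src (Const 1)) Skip"

definition up_check :: "'b \<Rightarrow> 'i com" where
  "up_check a = Cond (Equal (word 4) (Const 1))
     (Cond (Conj (Equal (Load (field 10 6)) (word 3)) (Less (Const 0) (word 6)))
       (Seq (check a (Load (field 12 6))) (decr 6)) Skip)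
     (check a (Const 0))"

definition up_prog :: "'b \<Rightarrow> 'i com" where
  "up_prog a = Seq (up_check a) (Seq (table (h a) (word 5) (Const 5))
     (Seq (incr 2) (Seq (decr 3) (Store (Const 4) (Const 1)))))"

text \<open>Besides delivering the answer this prepares the next pass: the words 2 to 6 and the
  sentinel in the words 10 to 12 are reset, while word 1 carries the verdict over.\<close>

definition end_prog :: "'i com" where
  "end_prog = Seq (Store (Const 0) (Arith Sub (Const 1) (word 1)))
     (foldr (\<lambda>i. Seq (Store (Const i) (Const 0))) [2, 3, 4, 5, 6, 10, 11, 12] Skip)"

lemma push_correct:
  assumes rep: "represents \<sigma> (Conf n d up r st ok)"
    and V: "n \<le> V" "d \<le> V" "r \<le> V" "m \<le> V" "13 + 3 * length st \<le> m"
  shows "safe m V l push \<sigma>" "represents (result l push \<sigma>) (Conf n d up 0 (Entry d n r # st) ok)"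
proof -
  define k where "k = length st"
  have k: "Suc (\<sigma> 6) = k" "k \<le> V" "12 + 3 * k < m" "length st = k" using rep V by (auto simp: k_def)
  have \<sigma>: "\<sigma> 2 = n" "\<sigma> 3 = d" "\<sigma> 5 = r" using rep by auto
  show "safe m V l push \<sigma>"
    using k(2,3) V(1-4) by (simp add: push_def k(1) \<sigma>)
  show "represents (result l push \<sigma>) (Conf n d up 0 (Entry d n r # st) ok)"
    using rep k by (simp add: push_def holds_stack_Cons)
qed

lemma down_tail_correct:
  assumes rep: "represents \<sigma> (Conf n d up r st ok)"
    and V: "n < V" "d < V" "K \<le> V" "m \<le> V" "10 + 3 * length st \<le> m"
    and st: "\<forall>x\<in>set st. state x < K"
  shows "safe m V l (down_tail a) \<sigma>"
    "represents (result l (down_tail a) \<sigma>) (Conf (Suc n) (Suc d) False r (upd_top a st) ok)"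
proof -
  obtain e p s st' where s: "st = Entry e p s # st'"
    using rep by (metis entry.exhaust list.exhaust length_0_conv old.nat.distinct(2) represents.simps)
  define k where "k = length st'"
  have k: "\<sigma> 6 = k" "k \<le> V" "12 + 3 * k < m" "length st' = k" using rep V by (auto simp: k_def s)
  have e: "entry \<sigma> k = Entry e p s" "holds_stack \<sigma> st'"
    using rep by (auto simp: s holds_stack_Cons k)
  then have f: "\<sigma> (12 + 3 * k) = s" by (simp add: entry_fields)
  have sK: "s < K" using st by (simp add: s)
  have table: "safe m V l (table (g a) (Load (field 12 6)) (field 12 6)) \<sigma>"
    "result l (table (g a) (Load (field 12 6)) (field 12 6)) \<sigma> = \<sigma>(12 + 3 * k := g a s)"
    using table_correct[of m V \<sigma> "Load (field 12 6)" "field 12 6" "g a" l] k V sK g_less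
    by (auto simp: f intro: less_imp_le less_le_trans)
  show "safe m V l (down_tail a) \<sigma>"
    using k V rep by (simp add: down_tail_def table)
  show "represents (result l (down_tail a) \<sigma>) (Conf (Suc n) (Suc d) False r (upd_top a st) ok)"
    using rep k e by (simp add: down_tail_def table s holds_stack_Cons)
qed

lemma down_prog_correct:
  fixes l :: "'i option"
  assumes rep: "represents \<sigma> (Conf n d up r st ok)" and inv: "invar (Conf n d up r st ok)"
    and V: "n < V" "K \<le> V" "m \<le> V" "13 + 3 * length st \<le> m"
  shows "\<exists>\<sigma>'. runs m V l (down_prog a)
      (compact_cost * length st + (30 + time (push :: 'i com) + time (down_tail a :: 'i com))) \<sigma> \<sigma>' \<and>
    represents \<sigma>' (step (Down a) (Conf n d up r st ok))"
proof (cases up)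
  case True
  have st: "st \<noteq> []" using inv by simp
  have desc: "\<forall>x\<in>set st. pos x \<le> n"
  proof
    fix x assume "x \<in> set st"
    then have "x = hd st \<or> x \<in> set (tl st)" by (cases st) auto
    then show "pos x \<le> n"
      using inv sparse_less[of "pos (hd st)" "tl st" x] by auto
  qed
  have bnd: "\<forall>x\<in>set st. pos x \<le> n \<and> depth x \<le> V \<and> state x \<le> V"
    using inv desc V by (fastforce intro: less_imp_le less_le_trans)
  have "holds_stack \<sigma> st" "\<sigma> 6 = length st - 1" "\<sigma> 2 = n" "n \<le> V" using rep V by auto
  then obtain \<sigma>1 where
    \<sigma>1: "runs m V l compact_prog (compact_cost * length st + 20) \<sigma> \<sigma>1"
      "holds_stack \<sigma>1 (compact_stack n st)" "\<sigma>1 6 = length (compact_stack n st) - 1"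
      "\<And>a. a < 6 \<Longrightarrow> \<sigma>1 a = \<sigma> a"
    using compact_prog_correct[OF st, of \<sigma> n V m l] bnd V(3,4) by metis
  have "length (compact_stack n st) > 0" using compact_nonempty[OF st] by simp
  then have rep1: "represents \<sigma>1 (Conf n d up r (compact_stack n st) ok)"
    using rep \<sigma>1 by simp
  have len: "13 + 3 * length (compact_stack n st) \<le> m"
    using V(4) length_compact[of n st] by linarith
  have push: "safe m V l push \<sigma>1"
    "represents (result l push \<sigma>1) (Conf n d up 0 (Entry d n r # compact_stack n st) ok)"
    using push_correct[OF rep1, of V m l] inv V len by auto
  have "\<forall>x\<in>set (Entry d n r # compact_stack n st). state x < K"
    using inv set_compact[of n st] by auto
  from down_tail_correct[OF push(2) V(1) _ V(2,3) _ this, of l a] inv V len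
  have tail: "safe m V l (down_tail a) (result l push \<sigma>1)"
    "represents (result l (down_tail a) (result l push \<sigma>1))
      (Conf (Suc n) (Suc d) False 0 (upd_top a (Entry d n r # compact_stack n st)) ok)"
    by auto
  have "bsafe m V \<sigma> (Equal (word 4) (Const 1))" "bval l \<sigma> (Equal (word 4) (Const 1))"
    using V rep True by auto
  then have "runs m V l (Cond (Equal (word 4) (Const 1)) (Seq compact_prog push) Skip)
      (compact_cost * length st + 30 + time (push :: 'i com)) \<sigma> (result l push \<sigma>1)"
    using runs_Seq[OF \<sigma>1(1) runs_result[OF push(1) order_refl] order_refl]
    by (intro runs_Cond[where ?T1.0 = "compact_cost * length st + 20 + time (push :: 'i com)"]) auto
  then have "runs m V l (down_prog a)
      (compact_cost * length st + (30 + time (push :: 'i com) + time (down_tail a :: 'i com))) \<sigma>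
      (result l (down_tail a) (result l push \<sigma>1))"
    unfolding down_prog_def
    by (rule runs_Seq[OF _ runs_result[OF tail(1) order_refl]]) simp
  then show ?thesis using tail(2) True by auto
next
  case False
  have tail: "safe m V l (down_tail a) \<sigma>"
    "represents (result l (down_tail a) \<sigma>) (Conf (Suc n) (Suc d) False r (upd_top a st) ok)"
    using down_tail_correct[OF rep V(1) _ V(2,3), of l a] inv V by auto
  have "bsafe m V \<sigma> (Equal (word 4) (Const 1))" "\<not> bval l \<sigma> (Equal (word 4) (Const 1))"
    using V rep False by auto
  then have "runs m V l (Cond (Equal (word 4) (Const 1)) (Seq compact_prog push) Skip) 6 \<sigma> \<sigma>"
    by (intro runs_Cond[where ?T1.0 = 1]) (auto intro: runs_Skip)
  then have "runs m V l (down_prog a)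
      (compact_cost * length st + (30 + time (push :: 'i com) + time (down_tail a :: 'i com))) \<sigma>
      (result l (down_tail a) \<sigma>)"
    unfolding down_prog_def
    by (rule runs_Seq[OF _ runs_result[OF tail(1) order_refl]]) simp
  then show ?thesis using tail(2) False by auto
qed

lemma check_correct:
  assumes rep: "represents \<sigma> (Conf n d up r st ok)"
    and V: "K \<le> V" "m \<le> V" "10 \<le> m" and src: "asafe m V \<sigma> src" "aval \<sigma> src < K"
  shows "safe m V l (check a src) \<sigma>"
    "represents (result l (check a src) \<sigma>) (Conf n d up r st (ok \<and> chk a (aval \<sigma> src)))"
proof -
  have "of_bool (\<not> chk a s) \<le> V" for s using V by (simp add: of_bool_def)
  then have table: "safe m V l (table (\<lambda>s. of_bool (\<not> chk a s)) src (Const 1)) \<sigma>"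
    "result l (table (\<lambda>s. of_bool (\<not> chk a s)) src (Const 1)) \<sigma> =
       \<sigma>(1 := of_bool (\<not> chk a (aval \<sigma> src)))"
    using table_correct[of m V \<sigma> src "Const 1" "\<lambda>s. of_bool (\<not> chk a s)" l] V src by auto
  show "safe m V l (check a src) \<sigma>" using table V by (simp add: check_def)
  show "represents (result l (check a src) \<sigma>) (Conf n d up r st (ok \<and> chk a (aval \<sigma> src)))"
    using rep table(2) by (simp add: check_def)
qed

text \<open>This isolates what an upward move does to the stack and the verdict; position, depth,
  direction and register change in the same way in all cases.\<close>

lemma up_check_correct:
  assumes rep: "represents \<sigma> (Conf n d up r st ok)" and inv: "invar (Conf n d up r st ok)"
    and V: "K \<le> V" "m \<le> V" "13 + 3 * length st \<le> m"
  shows "safe m V l (up_check a) \<sigma>"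
    "\<exists>st' ok'. represents (result l (up_check a) \<sigma>) (Conf n d up r st' ok') \<and>
       step (Up a) (Conf n d up r st ok) = Conf (Suc n) (d - 1) True (h a r) st' ok'"
proof -
  obtain e p s st' where st: "st = Entry e p s # st'"
    using rep by (metis entry.exhaust list.exhaust length_0_conv old.nat.distinct(2) represents.simps)
  define k where "k = length st'"
  have k: "\<sigma> 6 = k" "k \<le> V" "12 + 3 * k < m" "length st' = k" using rep V by (auto simp: k_def st)
  have e: "entry \<sigma> k = Entry e p s" "holds_stack \<sigma> st'"
    using rep by (auto simp: st holds_stack_Cons k)
  then have f: "\<sigma> (12 + 3 * k) = s" "\<sigma> (10 + 3 * k) = e" by (simp_all add: entry_fields)
  have sK: "s < K" using inv by (simp add: st)
  have "safe m V l (up_check a) \<sigma> \<and>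
    (\<exists>st' ok'. represents (result l (up_check a) \<sigma>) (Conf n d up r st' ok') \<and>
       step (Up a) (Conf n d up r st ok) = Conf (Suc n) (d - 1) True (h a r) st' ok')"
  proof (cases up)
    case False
    have "safe m V l (check a (Const 0)) \<sigma>"
      "represents (result l (check a (Const 0)) \<sigma>) (Conf n d up r st (ok \<and> chk a 0))"
      using check_correct[OF rep V(1,2), of "Const 0" l a] V K_pos by auto
    then show ?thesis using rep False V by (auto simp: up_check_def)
  next
    case True
    show ?thesis
    proof (cases "e = d \<and> st' \<noteq> []")
      case False
      then have "\<not> (e = d \<and> 0 < k)" by (auto simp: k_def)
      then show ?thesis using rep \<open>up\<close> False V k by (auto simp: up_check_def f st)
    next
      case match: True
      then have "0 < k" by (simp add: k_def)
      have src: "asafe m V \<sigma> (Load (field 12 6))" "aval \<sigma> (Load (field 12 6)) = s"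
        using V k by (simp_all add: f)
      have c: "safe m V l (check a (Load (field 12 6))) \<sigma>"
        "represents (result l (check a (Load (field 12 6))) \<sigma>) (Conf n d up r st (ok \<and> chk a s))"
        using check_correct[OF rep V(1,2) _ src(1), of l a] V sK unfolding src(2) by auto
      let ?\<sigma>1 = "result l (check a (Load (field 12 6))) \<sigma>"
      have "?\<sigma>1 6 = k" using c(2) by (simp add: st k)
      then have "represents (?\<sigma>1(6 := k - 1)) (Conf n d up r st' (ok \<and> chk a s))"
        using c(2) \<open>0 < k\<close> by (simp add: st k holds_stack_Cons)
      moreover have "safe m V l (up_check a) \<sigma>"
        using c rep True V k \<open>0 < k\<close> \<open>?\<sigma>1 6 = k\<close> match by (auto simp: up_check_def f)
      moreover have "result l (up_check a) \<sigma> = ?\<sigma>1(6 := k - 1)"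
        using rep True \<open>0 < k\<close> k \<open>?\<sigma>1 6 = k\<close> match by (auto simp: up_check_def f)
      ultimately show ?thesis using True match by (auto simp: st)
    qed
  qed
  then show "safe m V l (up_check a) \<sigma>"
    "\<exists>st' ok'. represents (result l (up_check a) \<sigma>) (Conf n d up r st' ok') \<and>
       step (Up a) (Conf n d up r st ok) = Conf (Suc n) (d - 1) True (h a r) st' ok'"
    by blast+
qed

lemma up_prog_correct:
  assumes rep: "represents \<sigma> (Conf n d up r st ok)" and inv: "invar (Conf n d up r st ok)"
    and V: "n < V" "K \<le> V" "m \<le> V" "13 + 3 * length st \<le> m"
  shows "safe m V l (up_prog a) \<sigma>"
    "represents (result l (up_prog a) \<sigma>) (step (Up a) (Conf n d up r st ok))"
proof -
  let ?\<sigma>1 = "result l (up_check a) \<sigma>"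
  obtain st' ok' where 1: "safe m V l (up_check a) \<sigma>" "represents ?\<sigma>1 (Conf n d up r st' ok')"
    "step (Up a) (Conf n d up r st ok) = Conf (Suc n) (d - 1) True (h a r) st' ok'"
    using up_check_correct[OF rep inv V(2-4), of l a] by blast
  have r: "r < K" "d \<le> n" using inv by auto
  have table: "safe m V l (table (h a) (word 5) (Const 5)) ?\<sigma>1"
    "result l (table (h a) (word 5) (Const 5)) ?\<sigma>1 = ?\<sigma>1(5 := h a r)"
    using table_correct[of m V ?\<sigma>1 "word 5" "Const 5" "h a" l] 1(2) V r h_less
    by (auto intro: less_imp_le less_le_trans)
  show "safe m V l (up_prog a) \<sigma>"
    using 1 table V r by (simp add: up_prog_def)
  show "represents (result l (up_prog a) \<sigma>) (step (Up a) (Conf n d up r st ok))"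
    using 1 table by (simp add: up_prog_def)
qed

lemma end_prog_correct:
  assumes rep: "represents \<sigma> (Conf n d up r st ok)" and V: "13 \<le> m" "m \<le> V"
  shows "safe m V l end_prog \<sigma>" "represents (result l end_prog \<sigma>) (init ok)"
    "result l end_prog \<sigma> 0 = of_bool ok"
  using assms
  by (auto simp: end_prog_def init_def holds_stack_def entry_def)

end

section \<open>The passes and their resources\<close>

lemma runs_mono: "runs m V x c T \<sigma> \<sigma>' \<Longrightarrow> T \<le> T' \<Longrightarrow> runs m V x c T' \<sigma> \<sigma>'"
  unfolding runs_def using order_trans by blast

lemma scan_append:
  "scan m V T c (xs @ ys) \<sigma> \<sigma>' \<longleftrightarrow> (\<exists>\<sigma>1. scan m V T c xs \<sigma> \<sigma>1 \<and> scan m V T c ys \<sigma>1 \<sigma>')"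
  by (induction xs arbitrary: \<sigma>) auto

context bounded_machine
begin

definition letter_prog :: "'b move \<Rightarrow> 'i com" where
  "letter_prog mv = (case mv of Down a \<Rightarrow> down_prog a | Up a \<Rightarrow> up_prog a)"

text \<open>When \<open>mvs\<close> lists all moves, only the end of the stream gets through to
  \<open>end_prog\<close>.\<close>

definition pass_prog :: "('b move \<Rightarrow> 'i) \<Rightarrow> 'b move list \<Rightarrow> 'i com" where
  "pass_prog tag mvs = foldr (\<lambda>mv. Cond (Letter (tag mv)) (letter_prog mv)) mvs end_prog"

text \<open>The time apart from compaction, the only part that grows with the stack.
  \<open>tag\<close> enters through its type, which fixes the alphabet of the commands.\<close>

definition letter_cost :: "('b move \<Rightarrow> 'i) \<Rightarrow> 'b move \<Rightarrow> nat" where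
  "letter_cost tag mv = (case mv of
     Down a \<Rightarrow> 30 + time (push :: 'i com) + time (down_tail a :: 'i com)
   | Up a \<Rightarrow> time (up_prog a :: 'i com))"

definition pass_cost :: "('b move \<Rightarrow> 'i) \<Rightarrow> 'b move list \<Rightarrow> nat" where
  "pass_cost tag mvs =
     time (end_prog :: 'i com) + 2 * length mvs + sum_list (map (letter_cost tag) mvs)"

lemma runs_pass_prog_letter:
  assumes "inj tag" "mv \<in> set mvs" "runs m V (Some (tag mv)) (letter_prog mv) T \<sigma> \<sigma>'"
  shows "runs m V (Some (tag mv)) (pass_prog tag mvs) (T + 2 * length mvs) \<sigma> \<sigma>'"
  using assms(2)
proof (induction mvs)
  case Nil
  then show ?case by simp
next
  case (Cons mv' mvs)
  show ?case
  proof (cases "mv' = mv")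
    case True
    then show ?thesis
      using assms(3) by (auto simp: pass_prog_def intro!: runs_Cond[where ?T1.0 = T])
  next
    case False
    then have "tag mv \<noteq> tag mv'" using assms(1) by (auto dest: injD)
    then show ?thesis
      using Cons False
      by (auto simp: pass_prog_def intro!: runs_Cond[where ?T1.0 = "T + 2 * length mvs"])
  qed
qed

lemma runs_pass_prog_end:
  fixes tag :: "'b move \<Rightarrow> 'i"
  assumes "runs m V None (end_prog :: 'i com) T \<sigma> \<sigma>'"
  shows "runs m V None (pass_prog tag mvs) (T + 2 * length mvs) \<sigma> \<sigma>'"
proof (induction mvs)
  case Nil
  then show ?case using assms by (simp add: pass_prog_def)
next
  case (Cons mv mvs)
  then show ?case
    by (auto simp: pass_prog_def intro!: runs_Cond[where ?T1.0 = "T + 2 * length mvs"])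
qed

fun conf_pos :: "conf \<Rightarrow> nat" where
  "conf_pos (Conf n d up r st ok) = n"

lemma conf_pos_step: "conf_pos (step mv c) = Suc (conf_pos c)"
  by (cases c; cases mv) simp_all

text \<open>\<open>L\<close> bounds the length of the stream, and the condition on \<open>k\<close>
  is the one that \<open>invar_length\<close> provides for stack heights. \<open>13 + 3 * k\<close>
  words leave room for one more entry, as a push requires.\<close>

definition resources :: "nat \<Rightarrow> nat \<Rightarrow> nat \<Rightarrow> nat \<Rightarrow> nat \<Rightarrow> bool" where
  "resources L m V T C \<longleftrightarrow> L < V \<and> K \<le> V \<and> 13 \<le> m \<and> m \<le> V \<and>
     (\<forall>k. 2 ^ (k - 2) \<le> Suc L \<longrightarrow> 13 + 3 * k \<le> m \<and> compact_cost * k + C \<le> T)"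

text \<open>Stack heights are at most \<open>2 + floorlog 2 (Suc L)\<close>, whence 19 as
  \<open>13 + 3 * 2\<close>.\<close>

lemma resourcesI:
  assumes "L < V" "K \<le> V" "m = 19 + 3 * floorlog 2 (Suc L)" "m \<le> V"
    and T: "compact_cost * (2 + floorlog 2 (Suc L)) + C \<le> T"
  shows "resources L m V T C"
  unfolding resources_def
proof (intro conjI allI impI)
  fix k :: nat assume "2 ^ (k - 2) \<le> Suc L"
  then have "Suc (k - 2) \<le> floorlog 2 (Suc L)"
    by (intro floorlog_geI) auto
  then have k: "k \<le> 2 + floorlog 2 (Suc L)" by simp
  then show "13 + 3 * k \<le> m" using assms(3) by simp
  show "compact_cost * k + C \<le> T"
    using mult_le_mono2[OF k, of compact_cost] T by linarith
qed (use assms in auto)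

lemma runs_letter_prog:
  fixes tag :: "'b move \<Rightarrow> 'i"
  assumes "represents \<sigma> (Conf n d up r st ok)" "invar (Conf n d up r st ok)" "n < L"
    and res: "resources L m V T C"
  shows "\<exists>\<sigma>'. runs m V (Some (tag mv)) (letter_prog mv) (compact_cost * length st + letter_cost tag mv) \<sigma> \<sigma>' \<and>
    represents \<sigma>' (step mv (Conf n d up r st ok))"
proof -
  have "2 ^ (length st - 2) \<le> Suc L"
    using invar_length[OF assms(2)] assms(3) by linarith
  then have V: "n < V" "K \<le> V" "m \<le> V" "13 + 3 * length st \<le> m"
    using res assms(3) by (auto simp: resources_def)
  show ?thesis
  proof (cases mv)
    case (Down a)
    show ?thesis
      using down_prog_correct[OF assms(1,2) V, of "Some (tag mv)" a]
      by (simp add: Down letter_prog_def letter_cost_def)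
  next
    case (Up a)
    have "runs m V (Some (tag mv)) (up_prog a) (compact_cost * length st + letter_cost tag mv) \<sigma>
      (result (Some (tag mv)) (up_prog a) \<sigma>)"
      by (rule runs_result[OF up_prog_correct(1)[OF assms(1,2) V]])
        (simp add: Up letter_cost_def)
    then show ?thesis
      using up_prog_correct(2)[OF assms(1,2) V, of "Some (tag mv)" a]
      unfolding Up letter_prog_def move.case by blast
  qed
qed

lemma scan_moves:
  assumes "inj tag" and res: "resources L m V T (pass_cost tag mvs)"
    and "set ms \<subseteq> set mvs" "represents \<sigma> c" "invar c" "conf_pos c + length ms \<le> L"
  shows "\<exists>\<sigma>'. scan m V T (pass_prog tag mvs) (map (\<lambda>mv. Some (tag mv)) ms) \<sigma> \<sigma>' \<and>
    represents \<sigma>' (steps ms c)"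
  using assms(3-)
proof (induction ms arbitrary: \<sigma> c)
  case Nil
  then show ?case by (simp add: steps_Nil)
next
  case (Cons mv ms)
  obtain n d up r st ok where c: "c = Conf n d up r st ok" by (cases c)
  have n: "n < L" using Cons.prems by (simp add: c)
  from runs_letter_prog[OF _ _ n res, of \<sigma> d up r st ok tag mv] Cons.prems(2,3)
  obtain \<sigma>1 where
    1: "runs m V (Some (tag mv)) (letter_prog mv) (compact_cost * length st + letter_cost tag mv) \<sigma> \<sigma>1"
      "represents \<sigma>1 (step mv c)"
    unfolding c by blast
  have "mv \<in> set mvs" using Cons.prems by simp
  then have "letter_cost tag mv \<le> sum_list (map (letter_cost tag) mvs)"
    by (intro member_le_sum_list) auto
  moreover have "2 ^ (length st - 2) \<le> Suc L"
    using invar_length Cons.prems(3) n unfolding c by (meson Suc_le_mono less_imp_le order_trans)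
  then have "compact_cost * length st + pass_cost tag mvs \<le> T"
    using res by (auto simp: resources_def)
  ultimately have "compact_cost * length st + letter_cost tag mv + 2 * length mvs \<le> T"
    by (simp add: pass_cost_def)
  then obtain k where k: "k \<le> T" "exec m V (Some (tag mv)) (pass_prog tag mvs) \<sigma> k \<sigma>1"
    using runs_mono[OF runs_pass_prog_letter[OF assms(1) \<open>mv \<in> set mvs\<close> 1(1)]]
    unfolding runs_def by blast
  moreover obtain \<sigma>' where "scan m V T (pass_prog tag mvs) (map (\<lambda>mv. Some (tag mv)) ms) \<sigma>1 \<sigma>'"
    "represents \<sigma>' (steps ms (step mv c))"
    using Cons.IH[OF _ 1(2) invar_step[OF Cons.prems(3)]] Cons.prems by (auto simp: conf_pos_step)
  ultimately show ?case by (auto simp: steps_Cons)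
qed

lemma scan_pass:
  fixes tag :: "'b move \<Rightarrow> 'i"
  assumes "inj tag" and res: "resources L m V T (pass_cost tag mvs)"
    and "set ms \<subseteq> set mvs" "represents \<sigma> (init ok)" "length ms \<le> L"
  shows "\<exists>\<sigma>'. scan m V T (pass_prog tag mvs) (map Some (map tag ms) @ [None]) \<sigma> \<sigma>' \<and>
    represents \<sigma>' (init (conf_ok (steps ms (init ok)))) \<and>
    \<sigma>' 0 = of_bool (conf_ok (steps ms (init ok)))"
proof -
  from scan_moves[OF assms(1-4) invar_init] assms(5) obtain \<sigma>1 where
    1: "scan m V T (pass_prog tag mvs) (map (\<lambda>mv. Some (tag mv)) ms) \<sigma> \<sigma>1"
      "represents \<sigma>1 (steps ms (init ok))" by (auto simp: init_def)
  obtain n d up r st ok' where c: "steps ms (init ok) = Conf n d up r st ok'" by (cases "steps ms (init ok)")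
  have V: "13 \<le> m" "m \<le> V" using res by (auto simp: resources_def)
  note e = end_prog_correct[OF 1(2)[unfolded c] V, of "None :: 'i option"]
  \<comment> \<open>Height 0 isolates the part of the time bound that has nothing to do with
    compaction.\<close>
  have "(2 :: nat) ^ (0 - 2) \<le> Suc L" by simp
  then have "compact_cost * 0 + pass_cost tag mvs \<le> T" using res unfolding resources_def by blast
  moreover have "runs m V None (pass_prog tag mvs) (time (end_prog :: 'i com) + 2 * length mvs) \<sigma>1 (result None (end_prog :: 'i com) \<sigma>1)"
    by (rule runs_pass_prog_end[OF runs_result[OF e(1) order_refl]])
  ultimately have "runs m V None (pass_prog tag mvs) T \<sigma>1 (result None (end_prog :: 'i com) \<sigma>1)"
    by (elim runs_mono) (simp add: pass_cost_def)
  then obtain k where "k \<le> T" "exec m V None (pass_prog tag mvs) \<sigma>1 k (result None (end_prog :: 'i com) \<sigma>1)"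
    unfolding runs_def by blast
  then have "scan m V T (pass_prog tag mvs) (map Some (map tag ms) @ [None]) \<sigma>
      (result None (end_prog :: 'i com) \<sigma>1)"
    using 1(1) by (auto simp: scan_append comp_def)
  then show ?thesis using e(2,3) unfolding c conf_ok.simps by blast
qed

end

section \<open>Asymptotic bounds and the final assembly\<close>

lemma const_bigo_log: "(\<lambda>N. c) \<in> O(\<lambda>N. log 2 (real N))"
proof (rule bigoI)
  show "\<forall>\<^sub>F N in sequentially. norm c \<le> \<bar>c\<bar> * norm (log 2 (real N))"
    using eventually_ge_at_top[of 2]
  proof eventually_elim
    case (elim N)
    then have "1 \<le> log 2 (real N)" by simp
    then show ?case by (simp add: mult_le_cancel_left1)
  qed
qed

text \<open>For positive \<open>N\<close>, \<open>a * N + b \<le> (a + b) * N\<close> turns the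
  constants into a summand of the logarithm, which is absorbed because \<open>log 2 N\<close> is at
  least 1 from 2 on.\<close>

lemma floorlog_bigo_log:
  assumes "0 < a"
  shows "(\<lambda>N. real (floorlog 2 (a * N + b))) \<in> O(\<lambda>N. log 2 (real N))"
proof (rule bigoI)
  define C where "C = log 2 (real (a + b))"
  show "\<forall>\<^sub>F N in sequentially.
    norm (real (floorlog 2 (a * N + b))) \<le> (2 + C) * norm (log 2 (real N))"
    using eventually_ge_at_top[of 2]
  proof eventually_elim
    case (elim N)
    then have log: "1 \<le> log 2 (real N)" by simp
    have C: "0 \<le> C" using assms by (simp add: C_def)
    have pos: "0 < a * N + b" using assms elim by simp
    have "b * 1 \<le> b * N" using elim by (intro mult_le_mono2) simp
    then have "a * N + b \<le> (a + b) * N" by (simp add: algebra_simps)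
    then have le: "real (a * N + b) \<le> real (a + b) * real N"
      by (metis of_nat_le_iff of_nat_mult)
    have "0 \<le> log 2 (real (a * N + b))" using pos by (subst zero_le_log_cancel_iff) linarith+
    then have "real (floorlog 2 (a * N + b)) \<le> 1 + log 2 (real (a * N + b))"
      using pos of_nat_floor[of "log 2 (real (a * N + b))"] unfolding floorlog_def by simp
    also have "\<dots> \<le> 1 + log 2 (real (a + b) * real N)"
      using log_mono[of 2 "real (a * N + b)", OF _ _ le] pos by linarith
    also have "\<dots> = 1 + C + log 2 (real N)"
      using assms elim by (simp add: log_mult C_def)
    also have "\<dots> \<le> (2 + C) * log 2 (real N)"
      using mult_left_mono[OF log, of "1 + C"] C by (simp add: algebra_simps)
    finally show ?case using log by simp
  qed
qed

lemma inj_forward_tag: "inj forward_tag"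
proof (rule injI)
  show "x = y" if "forward_tag x = forward_tag y" for x y :: "'b move"
    using that by (cases x; cases y) auto
qed

lemma inj_backward_tag: "inj backward_tag"
proof (rule injI)
  show "x = y" if "backward_tag x = backward_tag y" for x y :: "'b move"
    using that by (cases x; cases y) auto
qed

theorem theorem5:
  fixes D :: "'a::finite dtd"
  shows "\<exists>(A :: 'a option tag streaming_alg) (m :: nat \<Rightarrow> nat) (V :: nat \<Rightarrow> nat) (T :: nat \<Rightarrow> nat).
    length A = 2 \<and> bidirectional A \<and>
    (\<lambda>N. real (V N)) \<in> O(\<lambda>N. real N) \<and>
    (\<lambda>N. real (space (m N) (V N))) \<in> O(\<lambda>N. (log 2 (real N))\<^sup>2) \<and>
    (\<lambda>N. real (T N)) \<in> O(\<lambda>N. log 2 (real N)) \<and>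
    (\<forall>t :: 'a utree.
       outputs (m (num_nodes t)) (V (num_nodes t)) (T (num_nodes t)) A
         (xml (fcns_bot t)) (valid D t))"
proof -
  obtain Kb :: nat and \<delta>b :: "'a \<Rightarrow> nat \<Rightarrow> nat" and Fb where b:
    "0 < Kb" "\<And>a q. q < Kb \<Longrightarrow> \<delta>b a q < Kb" "\<And>a w. fold \<delta>b w 0 \<in> Fb a \<longleftrightarrow> w \<in> lang (D a)"
    using dtd_automaton[of D] by metis
  obtain Kf :: nat and \<delta>f :: "'a \<Rightarrow> nat \<Rightarrow> nat" and Ff where f:
    "0 < Kf" "\<And>a q. q < Kf \<Longrightarrow> \<delta>f a q < Kf" "\<And>a w. foldr \<delta>f w 0 \<in> Ff a \<longleftrightarrow> w \<in> lang (D a)"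
    using dtd_automaton_rev[of D] by metis
  interpret two_pass D \<delta>f \<delta>b Ff Fb
    using f(3) b(3) by unfold_locales auto
  have lift: "lift_step \<delta> a s < K" if "\<And>a q. q < K \<Longrightarrow> \<delta> a q < K" "s < K"
    for \<delta> :: "'a \<Rightarrow> nat \<Rightarrow> nat" and a s K
    using that by (cases a) auto
  interpret F: bounded_machine "\<lambda>_ s. s" "lift_step \<delta>f" "lift_check Ff" Kf
    using f(1,2) lift by unfold_locales auto
  interpret B: bounded_machine "lift_step \<delta>b" "\<lambda>_ _. 0" "lift_check Fb" Kb
    using b(1,2) lift by unfold_locales auto
  obtain as :: "'a option list" where "set as = UNIV"
    using finite_list[of "UNIV :: 'a option set"] by auto
  define mvs where "mvs = map Down as @ map Up as"
  have mvs: "set ms \<subseteq> set mvs" for ms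
    using \<open>set as = UNIV\<close> by (auto simp: mvs_def image_iff) (metis move.exhaust)
  define cf where "cf = F.pass_prog forward_tag mvs"
  define cb where "cb = B.pass_prog backward_tag mvs"
  define C where "C = F.pass_cost forward_tag mvs + B.pass_cost backward_tag mvs"
  \<comment> \<open>\<open>4 * N + 3\<close> is the successor of the bound \<open>4 * N + 2\<close>
    on the length of the stream.\<close>
  define H where "H N = floorlog 2 (4 * N + 3)" for N :: nat
  define m where "m N = 19 + 3 * H N" for N
  \<comment> \<open>Linear with room to spare: it exceeds the length of the stream, both numbers of
    states and \<open>m N\<close>, which is at most \<open>12 * N + 28\<close>.\<close>
  define V where "V N = 16 * N + (100 + Kf + Kb)" for N
  define T where "T N = compact_cost * (2 + H N) + C" for N
  have H: "H N \<le> 4 * N + 3" for N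
    unfolding H_def by (rule floorlog_leI) (simp_all add: less_exp)
  have "outputs (m N) (V N) (T N) [(Forward, cf), (Backward, cb)] (xml (fcns_bot t)) (valid D t)"
    if N: "N = num_nodes t" for t N
  proof -
    let ?t = "full_tree (fcns t)" and ?t' = "mirror_ftree (full_tree (fcns t))"
    have len: "length (moves ?t) \<le> 4 * N + 2" "length (moves ?t') \<le> 4 * N + 2"
      using length_moves_full_tree[of "fcns t"] by (simp_all add: size_fcns N)
    have H': "floorlog 2 (Suc (4 * N + 2)) = H N" by (simp add: H_def eval_nat_numeral)
    have "m N \<le> V N" using H[of N] by (simp add: m_def V_def)
    then have res: "F.resources (4 * N + 2) (m N) (V N) (T N) (F.pass_cost forward_tag mvs)"
      "B.resources (4 * N + 2) (m N) (V N) (T N) (B.pass_cost backward_tag mvs)"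
      by (intro F.resourcesI B.resourcesI; simp only: H'; simp add: m_def V_def T_def C_def)+
    have "F.represents (\<lambda>_. 0) (f.init True)"
      by (simp add: f.init_def holds_stack_def entry_def)
    from F.scan_pass[OF inj_forward_tag res(1) mvs this len(1)] obtain \<sigma>1 where
      1: "scan (m N) (V N) (T N) cf (map Some (map forward_tag (moves ?t)) @ [None]) (\<lambda>_. 0) \<sigma>1"
        "F.represents \<sigma>1 (f.init (f.conf_ok (f.steps (moves ?t) (f.init True))))"
      unfolding cf_def by blast
    from B.scan_pass[OF inj_backward_tag res(2) mvs _ len(2)] 1(2) obtain \<sigma>2 where
      2: "scan (m N) (V N) (T N) cb (map Some (map backward_tag (moves ?t')) @ [None]) \<sigma>1 \<sigma>2"
        "\<sigma>2 0 = of_bool (valid D t)"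
      unfolding cb_def by (metis two_passes fcns_valid)
    have w: "xml (fcns_bot t) = map forward_tag (moves ?t)"
      "rev (xml (fcns_bot t)) = map backward_tag (moves ?t')"
      by (simp_all only: fcns_bot_def xml_add_bot rev_xml_add_bot[unfolded xml_add_bot])
    have "run (m N) (V N) (T N) (xml (fcns_bot t)) [(Forward, cf), (Backward, cb)] (\<lambda>_. 0) \<sigma>2"
      using 1(1) 2(1) unfolding w[symmetric] by auto
    moreover have "\<sigma>2 0 = 1 \<longleftrightarrow> valid D t" using 2(2) by simp
    ultimately show ?thesis unfolding outputs_def by blast
  qed
  moreover have "bidirectional [(Forward, cf), (Backward, cb)]"
    by (auto simp: bidirectional_def)
  moreover have "(\<lambda>N. real (V N)) \<in> O(\<lambda>N. real N)"
  proof (rule bigoI)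
    show "\<forall>\<^sub>F N in sequentially. norm (real (V N)) \<le> (116 + Kf + Kb) * norm (real N)"
      using eventually_ge_at_top[of 1]
    proof eventually_elim
      case (elim N)
      then have "(100 + Kf + Kb) * 1 \<le> (100 + Kf + Kb) * N" by (intro mult_le_mono2) simp
      then have "V N \<le> (116 + Kf + Kb) * N" by (simp add: V_def algebra_simps)
      then have "real (V N) \<le> real ((116 + Kf + Kb) * N)" by (rule of_nat_mono)
      then show ?case by simp
    qed
  qed
  moreover have logH: "(\<lambda>N. real (H N)) \<in> O(\<lambda>N. log 2 (real N))"
    unfolding H_def by (rule floorlog_bigo_log) simp
  have T: "(\<lambda>N. real (T N)) \<in> O(\<lambda>N. log 2 (real N))"
  proof -
    have "(\<lambda>N. real (T N)) = (\<lambda>N. real (2 * compact_cost + C) + real compact_cost * real (H N))"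
      by (simp add: T_def algebra_simps)
    then show ?thesis
      using sum_in_bigo(1)[OF const_bigo_log[of "real (2 * compact_cost + C)"],
          of "\<lambda>N. real compact_cost * real (H N)"] logH by simp
  qed
  moreover have "(\<lambda>N. real (space (m N) (V N))) \<in> O(\<lambda>N. (log 2 (real N))\<^sup>2)"
  proof -
    have m: "(\<lambda>N. real (m N)) \<in> O(\<lambda>N. log 2 (real N))"
    proof -
      have "(\<lambda>N. real (m N)) = (\<lambda>N. 19 + 3 * real (H N))" by (simp add: m_def)
      then show ?thesis
        using sum_in_bigo(1)[OF const_bigo_log[of 19], of "\<lambda>N. 3 * real (H N)"] logH by simp
    qed
    have "(\<lambda>N. real (floorlog 2 (V N))) \<in> O(\<lambda>N. log 2 (real N))"
      unfolding V_def by (rule floorlog_bigo_log) simp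
    from landau_o.big.mult[OF m this]
    have "(\<lambda>N. real (m N) * real (floorlog 2 (V N))) \<in> O(\<lambda>N. (log 2 (real N))\<^sup>2)"
      by (simp add: power2_eq_square)
    moreover have "(\<lambda>N. 1) \<in> O(\<lambda>N. (log 2 (real N))\<^sup>2)"
      using landau_o.big.mult[OF const_bigo_log[of 1] const_bigo_log[of 1]]
      by (simp add: power2_eq_square)
    ultimately show ?thesis
      using sum_in_bigo(1) by (fastforce simp: space_def)
  qed
  ultimately show ?thesis
    by (intro exI[of _ "[(Forward, cf), (Backward, cb)]"] exI[of _ m] exI[of _ V] exI[of _ T]) simp
qed

end
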